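(* Let $1\le r\le n$ and $M\ge 1$ be integers, let $\boldsymbol{\gamma}=(\gamma_1,\dots,\gamma_r)\in(0,\infty)^r$ with $\gamma_1=n$, and let $F\in\mathcal{F}$. Let $\boldsymbol{X}_i=(X_i^{(1)},\dots,X_i^{(r)})$, $1\le i\le M$, be iid random vectors, each distributed as the first $r$ sequential order statistics based on $F$ and $\boldsymbol{\gamma}$, and put $U_i^{(j)}=F(X_i^{(j)})$. Let $\hat F_{\boldsymbol{\gamma}}$ be the Nelson-Aalen estimator of $F$ based on $\mathbf{X}=(X_i^{(j)})_{1\le i\le M,1\le j\le r}$ and let $\hat U_{\boldsymbol{\gamma}}$ be the Nelson-Aalen estimator based on $\mathbf{U}=(U_i^{(j)})_{1\le i\le M,1\le j\le r}$. Then for every $q\in(0,1]$ and any continuous mapping $T:[0,1]\times(0,1)\to\mathbb{R}$, the statistic $$\sup_{F^{-1}(0+)<t<F^{-1}(q)}T(\hat F_{\boldsymbol{\gamma}}(t),F(t))=\sup_{0<p<q}T(\hat U_{\boldsymbol{\gamma}}(p),p)\quad\text{(almost surely)}$$ is distribution-free with respect to $F\in\mathcal{F}$, i.e. for fixed $n,r,M,\boldsymbol{\gamma},q,T$ its distribution is the same for all $F\in\mathcal{F}$. Moreover, this property remains true if $\boldsymbol{\gamma}$ (in the estimators $\hat F_{\boldsymbol{\gamma}}$ and $\hat U_{\boldsymbol{\gamma}}$) is replaced by the profile likelihood estimator $\hat{\boldsymbol{\gamma}}^{\mathrm{PL}}$ or by the maximum likelihood estimator $\hat{\boldsymbol{\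gamma}}^{\mathrm{ML}}$.
   Context: $\mathcal{F}$ is the class of all absolutely continuous cumulative distribution functions (cdfs) $F$ with $F(0)=0$. For $F\in\mathcal{F}$, $\lambda_F(t)=-\frac{d}{dt}\ln(1-F(t))$ is the hazard rate, $F^{-1}$ is the quantile function corresponding to $F$, and $F^{-1}(0+)=\lim_{u\downarrow 0}F^{-1}(u)$. Sequential order statistics (SOSs). Let $1\le r\le n$ and let $\boldsymbol{\gamma}=(\gamma_1,\dots,\gamma_r)\in(0,\infty)^r$; one writes $\gamma_k=(n-k+1)\alpha_k$ with load-sharing parameters $\alpha_k>0$, and it is assumed throughout that $\alpha_1=1$, i.e. $\gamma_1=n$. Set $\gamma_{r+1}=0$. Increasingly ordered random variables $X^{(1)}\le\dots\le X^{(r)}$ are distributed as the first $r$ SOSs based on $F\in\mathcal{F}$ and $\boldsymbol{\gamma}$ if the counting process $N(t)=\sum_{j=1}^r\mathbf{1}_{\{X^{(j)}\le t\}}$, $t\ge 0$, has cumulative intensity process (compensator with respect to its natural filtration) $\Lambda(t)=\int_0^t\lambda_F(s)\,\gamma_{N(s-)+1}\,ds$, $t\ge0$. Nelson-Aalen estimator. For a data matrix $\mathbf{X}=(X_i^{(j)})_{1\le i\le M,1\le j\le r}$ let $N_k(t-)=\sum_{l=1}^r\mathbf{1}_{\{X_k^{(l)}<t\}}$. For a vector $\boldsymbol{g}=(g_1,\dots,g_r)$ with $g_{r+1}:=0$, put $$Y_i^{(j)}=\Big(\sum_{k=1}^M g_{N_k(X_i^{(j)}-)+1}\Big)^{-1},\qquad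 \hat F_{\boldsymbol{g}}(t)=1-\prod_{(i,j):\,X_i^{(j)}\le t}(1-Y_i^{(j)}),\quad t\ge 0.$$ $\hat U_{\boldsymbol{g}}$ is given by the same formulas with every $X_i^{(j)}$ replaced by $U_i^{(j)}$. Profile likelihood estimator. $\hat{\boldsymbol{\gamma}}^{\mathrm{PL}}=\arg\max_{\boldsymbol{g}}L(\boldsymbol{g},\mathbf{X})$, where the maximum is taken over $\boldsymbol{g}\in(0,\infty)^r$ with $g_1=n$, and, with $g_{r+1}:=0$, $$L(\boldsymbol{g},\mathbf{X})=\prod_{i=1}^M\prod_{j=1}^r\frac{g_j}{\sum_{k=1}^M g_{N_k(X_i^{(j)}-)+1}}.$$ Maximum likelihood estimator (for given baseline cdf $F$). $\hat\gamma_1^{\mathrm{ML}}=n$ and, for $2\le j\le r$, $\hat\gamma_j^{\mathrm{ML}}=(n-j+1)\,M\big/\sum_{i=1}^M S_i^{(j)}$, where $S_i^{(j)}=-(n-j+1)\ln\frac{1-F(X_i^{(j)})}{1-F(X_i^{(j-1)})}$. Here $F$ is the true baseline cdf of the data.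
   Formalization: The estimator can leave [0,1] (M=1, n=r=2, γ=(2,1/2) gives 3/2), where T is undefined; there T is replaced by an arbitrary continuous extended-real function. If the profile likelihood has several or no maximizers, a fixed choice depending only on the set of maximizers is used. *)

theory Defs
  imports "HOL-Probability.Probability"
begin

section \<open>Baseline distributions\<close>

definition ac_cdfs :: "(real \<Rightarrow> real) set" where
  "ac_cdfs = {cdf \<mu> | \<mu>. real_distribution \<mu> \<and> absolutely_continuous lborel \<mu> \<and> cdf \<mu> 0 = 0}"

text \<open>A cdf \<open>F\<close> as above is differentiable almost everywhere. Where \<open>F\<close> is not differentiable the
  value of \<^const>\<open>deriv\<close> is arbitrary, and beyond the right endpoint of the support the hazard
  rate is \<open>0\<close> because \<open>ln 0 = 0\<close>. Neither influences the processes defined below: the first set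
  is a null set, and the intensity vanishes after the last failure.\<close>

definition hazard_rate :: "(real \<Rightarrow> real) \<Rightarrow> real \<Rightarrow> real" where
  "hazard_rate F t = - deriv (\<lambda>s. ln (1 - F s)) t"

text \<open>The quantile function is extended-real valued, since the quantile at \<open>1\<close> may be \<open>\<infinity>\<close>.\<close>

definition quantile :: "(real \<Rightarrow> real) \<Rightarrow> real \<Rightarrow> ereal" where
  "quantile F u = (INF x\<in>{x. u \<le> F x}. ereal x)"

definition quantile_0_plus :: "(real \<Rightarrow> real) \<Rightarrow> ereal" where
  "quantile_0_plus F = Lim (at_right 0) (quantile F)"

section \<open>Martingales and compensators\<close>

definition generated_filtration :: "'a measure \<Rightarrow> (real \<Rightarrow> 'a \<Rightarrow> real) \<Rightarrow> real \<Rightarrow> 'a measure" where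
  "generated_filtration P Z t =
     sigma (space P) {Z s -` B \<inter> space P | s B. 0 \<le> s \<and> s \<le> t \<and> B \<in> sets borel}"

definition martingale :: "'a measure \<Rightarrow> (real \<Rightarrow> 'a measure) \<Rightarrow> (real \<Rightarrow> 'a \<Rightarrow> real) \<Rightarrow> bool" where
  "martingale P \<F> Z \<longleftrightarrow>
     (\<forall>t\<ge>0. Z t \<in> borel_measurable (\<F> t) \<and> integrable P (Z t)) \<and>
     (\<forall>s t. 0 \<le> s \<and> s \<le> t \<longrightarrow> (AE \<omega> in P. real_cond_exp P (\<F> s) (Z t) \<omega> = Z s \<omega>))"

section \<open>Sequential order statistics\<close>

text \<open>The vectors \<open>x\<close>, \<open>g\<close> and \<open>\<gamma>\<close> below carry the indices \<open>1, \<dots>, r\<close>; their values at other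
  indices are irrelevant.\<close>

definition failures :: "nat \<Rightarrow> (nat \<Rightarrow> real) \<Rightarrow> real \<Rightarrow> nat" where
  "failures r x t = (\<Sum>j=1..r. of_bool (x j \<le> t))"

definition failures_before :: "nat \<Rightarrow> (nat \<Rightarrow> real) \<Rightarrow> real \<Rightarrow> nat" where
  "failures_before r x t = (\<Sum>j=1..r. of_bool (x j < t))"

definition zero_ext :: "nat \<Rightarrow> (nat \<Rightarrow> real) \<Rightarrow> nat \<Rightarrow> real" where
  "zero_ext r g k = (if k \<in> {1..r} then g k else 0)"

definition sos_intensity ::
    "nat \<Rightarrow> (nat \<Rightarrow> real) \<Rightarrow> (real \<Rightarrow> real) \<Rightarrow> (nat \<Rightarrow> real) \<Rightarrow> real \<Rightarrow> real" where
  "sos_intensity r \<gamma> F x s = hazard_rate F s * zero_ext r \<gamma> (failures_before r x s + 1)"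

text \<open>A counting process starts at \<open>0\<close> and has jumps of size \<open>1\<close>, so the jump times are
  almost surely positive and pairwise distinct. Without the latter, the compensator would not
  determine the distribution. As the counting process is bounded, its compensator is
  integrable, and the local martingale in the definition of the compensator is a martingale.
  The cumulative intensity process is continuous and adapted, hence predictable.\<close>

definition sequential_order_statistics ::
    "'a measure \<Rightarrow> nat \<Rightarrow> (nat \<Rightarrow> real) \<Rightarrow> (real \<Rightarrow> real) \<Rightarrow> (nat \<Rightarrow> 'a \<Rightarrow> real) \<Rightarrow> bool" where
  "sequential_order_statistics P r \<gamma> F X \<longleftrightarrow>
     (\<forall>j\<in>{1..r}. X j \<in> borel_measurable P) \<and>
     (AE \<omega> in P. \<forall>j\<in>{1..r}. 0 < X j \<omega>) \<and>
     (AE \<omega> in P. \<forall>j\<in>{1..r}. \<forall>k\<in>{1..r}. j < k \<longrightarrow> X j \<omega> < X k \<omega>) \<and>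
     (AE \<omega> in P. \<forall>t\<ge>0. set_integrable lborel {0..t} (sos_intensity r \<gamma> F (\<lambda>j. X j \<omega>))) \<and>
     (let N = (\<lambda>t \<omega>. real (failures r (\<lambda>j. X j \<omega>) t));
          \<Lambda> = (\<lambda>t \<omega>. LBINT s:{0..t}. sos_intensity r \<gamma> F (\<lambda>j. X j \<omega>) s)
      in martingale P (generated_filtration P N) (\<lambda>t \<omega>. N t \<omega> - \<Lambda> t \<omega>))"

definition iid_sos_sample ::
    "'a measure \<Rightarrow> nat \<Rightarrow> nat \<Rightarrow> (nat \<Rightarrow> real) \<Rightarrow> (real \<Rightarrow> real) \<Rightarrow> (nat \<Rightarrow> nat \<Rightarrow> 'a \<Rightarrow> real) \<Rightarrow> bool"
where
  "iid_sos_sample P r M \<gamma> F X \<longleftrightarrow>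
     prob_space P \<and>
     (\<forall>i\<in>{1..M}. sequential_order_statistics P r \<gamma> F (X i)) \<and>
     (let V = (\<lambda>i \<omega>. \<lambda>j\<in>{1..r}. X i j \<omega>); S = PiM {1..r} (\<lambda>_. borel)
      in prob_space.indep_vars P (\<lambda>_. S) V {1..M} \<and>
         (\<forall>i\<in>{1..M}. \<forall>k\<in>{1..M}. distr P S (V i) = distr P S (V k)))"

section \<open>Estimators\<close>

text \<open>In a data matrix \<open>x\<close>, the entry \<open>x i j\<close> is the \<open>j\<close>-th failure time in the \<open>i\<close>-th system.\<close>

definition total_rate ::
    "nat \<Rightarrow> nat \<Rightarrow> (nat \<Rightarrow> real) \<Rightarrow> (nat \<Rightarrow> nat \<Rightarrow> real) \<Rightarrow> real \<Rightarrow> real" where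
  "total_rate r M g x t = (\<Sum>k=1..M. zero_ext r g (failures_before r (x k) t + 1))"

definition nelson_aalen ::
    "nat \<Rightarrow> nat \<Rightarrow> (nat \<Rightarrow> real) \<Rightarrow> (nat \<Rightarrow> nat \<Rightarrow> real) \<Rightarrow> real \<Rightarrow> real" where
  "nelson_aalen r M g x t =
     1 - (\<Prod>(i, j)\<in>{(i, j). i \<in> {1..M} \<and> j \<in> {1..r} \<and> x i j \<le> t}.
            1 - inverse (total_rate r M g x (x i j)))"

definition profile_likelihood ::
    "nat \<Rightarrow> nat \<Rightarrow> (nat \<Rightarrow> nat \<Rightarrow> real) \<Rightarrow> (nat \<Rightarrow> real) \<Rightarrow> real" where
  "profile_likelihood r M x g =
     (\<Prod>i=1..M. \<Prod>j=1..r. g j / total_rate r M g x (x i j))"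

text \<open>If the likelihood has several maximizers or none (both can happen, for instance for
  \<open>M = 1\<close>, where it is almost surely constant, or if all first failures precede all second
  failures), then \<^const>\<open>arg_max_on\<close> denotes some vector that depends on the data only through
  the set of maximizers.\<close>

definition gamma_PL :: "nat \<Rightarrow> nat \<Rightarrow> nat \<Rightarrow> (nat \<Rightarrow> nat \<Rightarrow> real) \<Rightarrow> nat \<Rightarrow> real" where
  "gamma_PL n r M x =
     arg_max_on (profile_likelihood r M x) {g \<in> {1..r} \<rightarrow>\<^sub>E {0<..}. g 1 = real n}"

definition normalized_spacing ::
    "nat \<Rightarrow> (real \<Rightarrow> real) \<Rightarrow> (nat \<Rightarrow> nat \<Rightarrow> real) \<Rightarrow> nat \<Rightarrow> nat \<Rightarrow> real" where
  "normalized_spacing n F x i j =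
     - (real n - real j + 1) * ln ((1 - F (x i j)) / (1 - F (x i (j - 1))))"

definition gamma_ML ::
    "nat \<Rightarrow> nat \<Rightarrow> (real \<Rightarrow> real) \<Rightarrow> (nat \<Rightarrow> nat \<Rightarrow> real) \<Rightarrow> nat \<Rightarrow> real" where
  "gamma_ML n M F x j =
     (if j = 1 then real n
      else (real n - real j + 1) * real M / (\<Sum>i=1..M. normalized_spacing n F x i j))"

section \<open>The statistics\<close>

text \<open>The estimator may leave \<open>[0,1]\<close> (if the total rate is less than \<open>1\<close> at some failure), where
  \<open>T\<close> is not defined. The function \<open>E\<close> fixes how such values enter the supremum: for example
  \<open>E = -\<infinity>\<close> ignores them, and \<open>E (x, p) = T (max 0 (min 1 x), p)\<close> truncates the estimator. The
  supremum is taken in the extended reals because \<open>T\<close> need not be bounded.\<close>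

definition completed :: "(real \<times> real \<Rightarrow> real) \<Rightarrow> (real \<times> real \<Rightarrow> ereal) \<Rightarrow> real \<times> real \<Rightarrow> ereal" where
  "completed T E z = (if z \<in> {0..1} \<times> {0<..<1} then ereal (T z) else E z)"

definition sup_statistic ::
    "(real \<times> real \<Rightarrow> real) \<Rightarrow> (real \<times> real \<Rightarrow> ereal) \<Rightarrow> real \<Rightarrow> (real \<Rightarrow> real) \<Rightarrow> (real \<Rightarrow> real) \<Rightarrow> ereal"
where
  "sup_statistic T E q F Fhat =
     (SUP t\<in>{t. quantile_0_plus F < ereal t \<and> ereal t < quantile F q}. completed T E (Fhat t, F t))"

definition sup_statistic_uniform ::
    "(real \<times> real \<Rightarrow> real) \<Rightarrow> (real \<times> real \<Rightarrow> ereal) \<Rightarrow> real \<Rightarrow> (real \<Rightarrow> real) \<Rightarrow> ereal" where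
  "sup_statistic_uniform T E q Uhat = (SUP p\<in>{0<..<q}. completed T E (Uhat p, p))"

end

theory Submission
  imports Defs
begin

text \<open>
  By Lebesgue's differentiation theorem the hazard rate is almost everywhere \<open>D / (1 - F)\<close> for a
  density \<open>D\<close>, so that the cumulative hazard is \<open>H = - ln (1 - F)\<close>. The martingale property says
  that the measures \<open>C \<mapsto> E \<integral> 1\<^sub>C dN\<close> and \<open>C \<mapsto> E \<integral> 1\<^sub>C d\<Lambda>\<close> agree on predictable rectangles, hence
  on the predictable sigma-algebra. Evaluated at the set of times between the \<open>(j - 1)\<close>-st and the
  \<open>j\<close>-th failure at which \<open>H\<close> has grown by more than \<open>c\<close>, this is an integral equation for the
  conditional survival function of \<open>H (X j) - H (X (j - 1))\<close> given the past, whose only solution is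
  \<open>exp (- \<gamma> j * c)\<close>. So the law of the transformed failure times \<open>F (X j)\<close> does not depend on \<open>F\<close>.
  Almost surely no \<open>X j\<close> lies in an interval of constancy of \<open>F\<close>, so \<open>F\<close> preserves the order of
  the data, on which the estimators depend, and the statistic is a function of the transformed sample.
\<close>

section \<open>Lebesgue differentiation on the line\<close>

text \<open>The hazard rate is given pointwise by \<open>deriv\<close>, whereas expectations need a
  density. The differentiation theorem serves only to replace \<open>hazard_rate\<close> by
  \<open>lam\<close> almost everywhere; all further calculus goes through the probability integral
  transform, so \<open>cumhaz\<close> is never differentiated. The filtration is generated by the
  counts alone. An event about earlier failure times can be tested against the compensator at time
  \<open>s\<close> only if it is expressed by counts before \<open>s\<close>; this dictates the
  censored times \<open>seen\<close> and the sets \<open>window\<close>. Between two consecutive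
  failures the rate is the constant \<open>\<gamma> j\<close>. Let p(c) be the probability that a
  past event holds and the j-th spacing of \<open>cumhaz\<close> exceeds c. Comparing the two
  measures on a window gives p(c) = \<open>\<gamma> j\<close> times the expectation of (spacing -
  c)^+ on the past event, which is \<open>\<gamma> j\<close> times the integral of p over (c,
  infinity). This forces exponential decay, and because the past event is arbitrary among events on
  earlier spacings exceeding thresholds, also independence. Flat pieces of the cdf are handled
  through the countably many levels that it takes at rational points.\<close>

lemma emeasure_le_of_fine_cover:
  fixes m1 m2 :: "real measure" and S :: "real set"
  assumes sets1: "sets m1 = sets borel" and sets2: "sets m2 = sets borel"
    and fin: "emeasure m2 (space m2) \<noteq> \<infinity>"
    and ac: "absolutely_continuous lborel m1"
    and S: "S \<in> sets borel"
    and cover: "\<And>x d. x \<in> S \<Longrightarrow> 0 < d \<Longrightarrow>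
      \<exists>u v. u < x \<and> x < v \<and> v - u < d \<and> emeasure m1 {u..v} \<le> emeasure m2 {u..v}"
  shows "emeasure m1 S \<le> emeasure m2 S"
proof -
  \<comment> \<open>Vitali's theorem exhausts \<open>S\<close>, up to a Lebesgue null set, by
    disjoint favourable intervals inside \<open>U\<close>. The rest is null for \<open>m1\<close> by
    absolute continuity, and outer regularity of the finite measure \<open>m2\<close> finally
    shrinks \<open>U\<close> to \<open>S\<close>.\<close>
  have "emeasure m1 S \<le> emeasure m2 U" if U: "S \<subseteq> U" "open U" for U
  proof -
    define K where "K = {(u, v). u < v \<and> {u..v} \<subseteq> U \<and> emeasure m1 {u..v} \<le> emeasure m2 {u..v}}"
    define a r where "a = (\<lambda>(u::real, v). (u + v) / 2)" and "r = (\<lambda>(u::real, v). (v - u) / 2)"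
    have ball: "cball (a (u, v)) (r (u, v)) = {u..v}" for u v
      unfolding cball_eq_atLeastAtMost by (simp add: a_def r_def field_simps)
    have fine: "\<exists>i. i \<in> K \<and> x \<in> cball (a i) (r i) \<and> r i < d" if x: "x \<in> S" and d: "0 < d" for x d
    proof -
      obtain e where e: "e > 0" "ball x e \<subseteq> U"
        using U x open_contains_ball by blast
      obtain u v where uv: "u < x" "x < v" "v - u < min d e" "emeasure m1 {u..v} \<le> emeasure m2 {u..v}"
        using cover[OF x, of "min d e"] d e by auto
      have "{u..v} \<subseteq> ball x e" using uv by (auto simp: dist_real_def)
      then have "(u, v) \<in> K" using uv e by (auto simp: K_def)
      moreover have "x \<in> cball (a (u, v)) (r (u, v))" using uv by (simp add: ball del: mem_cball)
      moreover have "r (u, v) < d" using uv by (simp add: r_def)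
      ultimately show ?thesis by blast
    qed
    have rpos: "\<And>i. i \<in> K \<Longrightarrow> 0 < r i" by (auto simp: K_def r_def)
    obtain C where C: "countable C" "C \<subseteq> K"
      and disj: "pairwise (\<lambda>i j. disjnt (cball (a i) (r i)) (cball (a j) (r j))) C"
      and neg: "negligible (S - (\<Union>i\<in>C. cball (a i) (r i)))"
      using Vitali_covering_theorem_cballs[OF rpos fine] by blast
    define B where "B = (\<lambda>i. cball (a i) (r i))"
    have Bb: "B i \<in> sets borel" for i by (simp add: B_def)
    have UB: "(\<Union>i\<in>C. B i) \<in> sets borel" using C Bb by (intro sets.countable_UN'') auto
    have N: "S - (\<Union>i\<in>C. B i) \<in> null_sets lborel"
      using neg S UB null_sets_completion_iff[of "S - (\<Union>i\<in>C. B i)" lborel]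
      by (auto simp: negligible_iff_null_sets B_def)
    then have N1: "emeasure m1 (S - (\<Union>i\<in>C. B i)) = 0"
      using ac by (auto simp: absolutely_continuous_def)
    have dB: "disjoint_family_on B C"
      using disj by (auto simp: disjoint_family_on_def pairwise_def disjnt_def B_def)
    have "emeasure m1 S \<le> emeasure m1 ((S - (\<Union>i\<in>C. B i)) \<union> (\<Union>i\<in>C. B i))"
      using S UB by (intro emeasure_mono) (auto simp: sets1)
    also have "\<dots> \<le> emeasure m1 (S - (\<Union>i\<in>C. B i)) + emeasure m1 (\<Union>i\<in>C. B i)"
      using S UB by (intro emeasure_subadditive) (auto simp: sets1)
    also have "\<dots> = emeasure m1 (\<Union>i\<in>C. B i)" by (simp add: N1)
    also have "\<dots> = (\<integral>\<^sup>+i. emeasure m1 (B i) \<partial>count_space C)"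
      using C dB Bb by (intro emeasure_UN_countable) (auto simp: sets1)
    also have "\<dots> \<le> (\<integral>\<^sup>+i. emeasure m2 (B i) \<partial>count_space C)"
      using C by (intro nn_integral_mono) (auto simp: K_def B_def ball)
    also have "\<dots> = emeasure m2 (\<Union>i\<in>C. B i)"
      using C dB Bb by (intro emeasure_UN_countable[symmetric]) (auto simp: sets2)
    also have "\<dots> \<le> emeasure m2 U"
    proof (rule emeasure_mono)
      have "B i \<subseteq> U" if "i \<in> C" for i
        using that C by (cases i) (auto simp: K_def B_def ball simp del: mem_cball)
      then show "(\<Union>i\<in>C. B i) \<subseteq> U" by blast
    qed (use U sets2 in auto)
    finally show ?thesis .
  qed
  then show ?thesis
    unfolding outer_regular[OF sets2 fin S] by (intro INF_greatest) auto
qed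

text \<open>The points at which intervals with the property \<open>R\<close> form a Vitali cover.\<close>

definition fine_set :: "(real \<Rightarrow> real \<Rightarrow> bool) \<Rightarrow> real set" where
  "fine_set R = {x. \<forall>d>0. \<exists>u v. u < x \<and> x < v \<and> v - u < d \<and> R u v}"

text \<open>For a fixed bound \<open>d\<close> the admissible points form a union of open intervals,
  and bounds \<open>d\<close> of the form 1/(n+1) suffice. So the set is a G-delta, whatever
  \<open>R\<close> is.\<close>

lemma fine_set_borel [measurable]: "fine_set R \<in> sets borel"
proof -
  let ?O = "\<lambda>d. \<Union>{{u<..<v} | u v. v - u < d \<and> R u v}"
  have "fine_set R = (\<Inter>n. ?O (inverse (real (Suc n))))"
  proof (intro equalityI subsetI)
    fix x assume "x \<in> fine_set R"
    show "x \<in> (\<Inter>n. ?O (inverse (real (Suc n))))"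
    proof (intro INT_I)
      fix n
      have "0 < inverse (real (Suc n))" by simp
      then obtain u v where "u < x" "x < v" "v - u < inverse (real (Suc n))" "R u v"
        using \<open>x \<in> fine_set R\<close> unfolding fine_set_def by blast
      then show "x \<in> ?O (inverse (real (Suc n)))" by (intro UnionI[of "{u<..<v}"]) auto
    qed
  next
    fix x assume x: "x \<in> (\<Inter>n. ?O (inverse (real (Suc n))))"
    show "x \<in> fine_set R"
      unfolding fine_set_def
    proof (intro CollectI allI impI)
      fix d :: real assume "0 < d"
      then obtain n where n: "inverse (real (Suc n)) < d" using reals_Archimedean by blast
      from x have "x \<in> ?O (inverse (real (Suc n)))" by blast
      then show "\<exists>u v. u < x \<and> x < v \<and> v - u < d \<and> R u v" using n by fastforce
    qed
  qed
  also have "\<dots> \<in> sets borel"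
    by (intro sets.countable_INT'' borel_open open_Union) auto
  finally show ?thesis .
qed

section \<open>Densities as almost-everywhere derivatives of distribution functions\<close>

locale density_measure =
  fixes D :: "real \<Rightarrow> real" and M :: "real measure"
  assumes D_meas [measurable]: "D \<in> borel_measurable borel"
    and D_nonneg: "\<And>x. 0 \<le> D x"
    and M_def: "M = density lborel (\<lambda>x. ennreal (D x))"
    and fin: "finite_measure M"
begin

sublocale finite_measure M by (rule fin)

lemma sets_M [simp]: "sets M = sets borel" and space_M [simp]: "space M = UNIV"
  by (simp_all add: M_def)

lemma ac_M: "absolutely_continuous lborel M"
  unfolding M_def by (intro absolutely_continuousI_density) measurable

text \<open>Cut off to a bounded interval because the covering comparison needs a finite measure on
  its larger side.\<close>

definition scaled :: "real \<Rightarrow> real \<Rightarrow> real measure" where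
  "scaled c R = density lborel (\<lambda>x. ennreal c * indicator {-R..R} x)"

lemma emeasure_scaled: "A \<in> sets borel \<Longrightarrow> A \<subseteq> {-R..R} \<Longrightarrow> emeasure (scaled c R) A = ennreal c * emeasure lborel A"
  unfolding scaled_def
  by (subst emeasure_density)
    (auto simp: mult.assoc nn_integral_cmult Int_absorb2 Int_absorb1 simp flip: indicator_inter_arith)

lemma sets_scaled [simp]: "sets (scaled c R) = sets borel" and space_scaled [simp]: "space (scaled c R) = UNIV"
  by (simp_all add: scaled_def)

lemma scaled_fin: "emeasure (scaled c R) UNIV \<noteq> \<infinity>"
proof -
  have "emeasure (scaled c R) UNIV = (\<integral>\<^sup>+x. ennreal c * indicator {-R..R} x \<partial>lborel)"
    unfolding scaled_def by (subst emeasure_density) auto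
  also have "\<dots> = ennreal c * emeasure lborel {-R..R}" by (simp add: nn_integral_cmult)
  also have "\<dots> < \<infinity>" by (simp add: ennreal_mult_less_top emeasure_lborel_Icc_eq)
  finally show ?thesis by simp
qed

lemma emeasure_M_bounds:
  assumes A: "A \<in> sets borel"
  shows "(\<And>x. x \<in> A \<Longrightarrow> D x \<le> c) \<Longrightarrow> emeasure M A \<le> ennreal c * emeasure lborel A"
    and "(\<And>x. x \<in> A \<Longrightarrow> c \<le> D x) \<Longrightarrow> ennreal c * emeasure lborel A \<le> emeasure M A"
  using A unfolding M_def
  by (auto simp: emeasure_density nn_integral_cmult_indicator[symmetric] simp flip: nn_integral_cmult_indicator
      intro!: nn_integral_mono ennreal_leI split: split_indicator)

lemma null_of_gap:
  fixes A :: "real set"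
  assumes "A \<in> sets borel" "A \<subseteq> {-R..R}" "0 \<le> a" "a < b"
    "ennreal b * emeasure lborel A \<le> ennreal a * emeasure lborel A"
  shows "A \<in> null_sets lborel"
proof -
  have "emeasure lborel A \<le> emeasure lborel {-R..R}" using assms by (intro emeasure_mono) simp_all
  also have "\<dots> < \<infinity>" by (simp add: emeasure_lborel_Icc_eq)
  finally obtain m where m: "emeasure lborel A = ennreal m" "0 \<le> m" by (cases "emeasure lborel A") auto
  with assms have "b * m \<le> a * m" by (simp add: ennreal_mult[symmetric])
  with m \<open>a < b\<close> have "m = 0" by (simp add: mult_le_cancel_right)
  with m assms show ?thesis by auto
qed

text \<open>On this set the density bounds \<open>M\<close> above by \<open>c'\<close> times length,
  while the covering comparison bounds it below by \<open>c\<close> times length. As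
  \<open>c' < c\<close>, both can hold only on a null set.\<close>

lemma null_upper:
  assumes c: "0 \<le> c'" "c' < c"
  shows "{x. D x \<le> c'} \<inter> {-R<..<R} \<inter> fine_set (\<lambda>u v. ennreal (c * (v - u)) \<le> emeasure M {u..v}) \<in> null_sets lborel"
    (is "?S \<in> _")
proof -
  have S: "?S \<in> sets borel" by measurable
  have "emeasure (scaled c R) ?S \<le> emeasure M ?S"
  proof (rule emeasure_le_of_fine_cover)
    show "absolutely_continuous lborel (scaled c R)"
      unfolding scaled_def by (intro absolutely_continuousI_density) measurable
  next
    fix x d :: real assume x: "x \<in> ?S" and d: "0 < d"
    from x have "0 < min d (min (R - x) (x + R))" using d by auto
    then obtain u v where uv: "u < x" "x < v" "v - u < min d (min (R - x) (x + R))" "ennreal (c * (v - u)) \<le> emeasure M {u..v}"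
      using x unfolding fine_set_def by blast
    then have "{u..v} \<subseteq> {-R..R}" by auto
    then have "emeasure (scaled c R) {u..v} = ennreal (c * (v - u))"
      using uv c by (subst emeasure_scaled) (auto simp: ennreal_mult)
    with uv show "\<exists>u v. u < x \<and> x < v \<and> v - u < d \<and> emeasure (scaled c R) {u..v} \<le> emeasure M {u..v}"
      by (intro exI[of _ u] exI[of _ v]) simp
  qed (use S emeasure_finite in auto)
  also have "emeasure M ?S \<le> ennreal c' * emeasure lborel ?S"
    using S by (intro emeasure_M_bounds) auto
  finally have "emeasure (scaled c R) ?S \<le> ennreal c' * emeasure lborel ?S" .
  moreover have "emeasure (scaled c R) ?S = ennreal c * emeasure lborel ?S"
    using S by (intro emeasure_scaled) auto
  ultimately show ?thesis using S c by (intro null_of_gap[of _ R c' c]) auto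
qed

text \<open>Mirror image of \<open>null_upper\<close>: in the covering comparison, \<open>M\<close>
  and scaled Lebesgue measure change places.\<close>

lemma null_lower:
  assumes c: "0 \<le> c'" "c' < c"
  shows "{x. c \<le> D x} \<inter> {-R<..<R} \<inter> fine_set (\<lambda>u v. emeasure M {u..v} \<le> ennreal (c' * (v - u))) \<in> null_sets lborel"
    (is "?S \<in> _")
proof -
  have S: "?S \<in> sets borel" by measurable
  have "ennreal c * emeasure lborel ?S \<le> emeasure M ?S"
    using S by (intro emeasure_M_bounds) auto
  also have "emeasure M ?S \<le> emeasure (scaled c' R) ?S"
  proof (rule emeasure_le_of_fine_cover)
    fix x d :: real assume x: "x \<in> ?S" and d: "0 < d"
    from x have "0 < min d (min (R - x) (x + R))" using d by auto
    then obtain u v where uv: "u < x" "x < v" "v - u < min d (min (R - x) (x + R))" "emeasure M {u..v} \<le> ennreal (c' * (v - u))"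
      using x unfolding fine_set_def by blast
    then have "{u..v} \<subseteq> {-R..R}" by auto
    then have "emeasure (scaled c' R) {u..v} = ennreal (c' * (v - u))"
      using uv c by (subst emeasure_scaled) (auto simp: ennreal_mult)
    with uv show "\<exists>u v. u < x \<and> x < v \<and> v - u < d \<and> emeasure M {u..v} \<le> emeasure (scaled c' R) {u..v}"
      by (intro exI[of _ u] exI[of _ v]) simp
  qed (use S scaled_fin ac_M in auto)
  also have "emeasure (scaled c' R) ?S = ennreal c' * emeasure lborel ?S"
    using S by (intro emeasure_scaled) auto
  finally show ?thesis using S c by (intro null_of_gap[of _ R c' c]) auto
qed

lemma measure_singleton: "measure M {x} = 0"
  using ac_M by (auto simp: absolutely_continuous_def null_sets_def subset_eq measure_def)

abbreviation "Fn \<equiv> cdf M"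

lemma isCont_Fn: "isCont Fn x"
proof -
  interpret finite_borel_measure M by unfold_locales simp
  show ?thesis by (simp add: isCont_cdf measure_singleton)
qed

lemma measure_Icc: assumes "u \<le> v" shows "measure M {u..v} = Fn v - Fn u"
proof -
  have "{..v} = {..<u} \<union> {u..v}" using assms by auto
  then have "Fn v = measure M {..<u} + measure M {u..v}"
    by (simp add: cdf_def) (subst finite_measure_Union, auto)
  moreover have "{..u} = {..<u} \<union> {u}" by auto
  then have "Fn u = measure M {..<u} + measure M {u}"
    by (simp add: cdf_def del: Un_insert_right) (subst finite_measure_Union, auto)
  ultimately show ?thesis by (simp add: measure_singleton)
qed

text \<open>\<open>fine_set\<close> speaks of intervals with \<open>x\<close> in their interior, but
  difference quotients have \<open>x\<close> as an endpoint. Widening by \<open>e\<close> on both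
  sides and letting \<open>e\<close> tend to 0 bridges this, by continuity of the cdf.\<close>

lemma slope_le:
  assumes "x \<notin> fine_set (\<lambda>u v. ennreal (c * (v - u)) \<le> emeasure M {u..v})" "0 \<le> c"
  shows "\<exists>d>0. \<forall>u v. u \<le> x \<longrightarrow> x \<le> v \<longrightarrow> v - u < d \<longrightarrow> Fn v - Fn u \<le> c * (v - u)"
proof -
  from assms obtain d where d: "d > 0" and *: "\<And>u v. u < x \<Longrightarrow> x < v \<Longrightarrow> v - u < d \<Longrightarrow> \<not> ennreal (c * (v - u)) \<le> emeasure M {u..v}"
    unfolding fine_set_def by blast
  have 1: "Fn v - Fn u \<le> c * (v - u)" if "u < x" "x < v" "v - u < d" for u v
  proof -
    have "emeasure M {u..v} \<le> ennreal (c * (v - u))" using *[OF that] by simp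
    then have "measure M {u..v} \<le> c * (v - u)"
      using assms that by (simp add: emeasure_eq_measure)
    with measure_Icc[of u v] that show ?thesis by simp
  qed
  have "Fn v - Fn u \<le> c * (v - u)" if uv: "u \<le> x" "x \<le> v" "v - u < d" for u v
  proof (rule tendsto_le[of "at_right (0::real)"])
    show "((\<lambda>e. c * ((v + e) - (u - e))) \<longlongrightarrow> c * (v - u)) (at_right 0)"
      by (auto intro!: tendsto_eq_intros)
    have "((\<lambda>e. v + e) \<longlongrightarrow> v) (at_right 0)" "((\<lambda>e. u - e) \<longlongrightarrow> u) (at_right 0)" by (auto intro!: tendsto_eq_intros)
    then show "((\<lambda>e. Fn (v + e) - Fn (u - e)) \<longlongrightarrow> Fn v - Fn u) (at_right 0)"
      by (intro tendsto_diff isCont_tendsto_compose[OF isCont_Fn])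
    have "\<forall>\<^sub>F e in at_right 0. e < (d - (v - u)) / 2"
      using uv unfolding eventually_at_right_field by (intro exI[of _ "(d - (v - u)) / 2"]) auto
    moreover have "\<forall>\<^sub>F e in at_right (0::real). 0 < e" by (rule eventually_at_right_less)
    ultimately show "\<forall>\<^sub>F e in at_right 0. Fn (v + e) - Fn (u - e) \<le> c * ((v + e) - (u - e))"
      by eventually_elim (use uv in \<open>intro 1, auto\<close>)
  qed auto
  with d show ?thesis by blast
qed

lemma slope_ge:
  assumes "x \<notin> fine_set (\<lambda>u v. emeasure M {u..v} \<le> ennreal (c * (v - u)))" "0 \<le> c"
  shows "\<exists>d>0. \<forall>u v. u \<le> x \<longrightarrow> x \<le> v \<longrightarrow> v - u < d \<longrightarrow> c * (v - u) \<le> Fn v - Fn u"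
proof -
  from assms obtain d where d: "d > 0" and *: "\<And>u v. u < x \<Longrightarrow> x < v \<Longrightarrow> v - u < d \<Longrightarrow> \<not> emeasure M {u..v} \<le> ennreal (c * (v - u))"
    unfolding fine_set_def by blast
  have 1: "c * (v - u) \<le> Fn v - Fn u" if "u < x" "x < v" "v - u < d" for u v
  proof -
    have "ennreal (c * (v - u)) \<le> emeasure M {u..v}" using *[OF that] by simp
    then have "c * (v - u) \<le> measure M {u..v}"
      using assms that by (simp add: emeasure_eq_measure)
    with measure_Icc[of u v] that show ?thesis by simp
  qed
  have "c * (v - u) \<le> Fn v - Fn u" if uv: "u \<le> x" "x \<le> v" "v - u < d" for u v
  proof (rule tendsto_le[of "at_right (0::real)"])
    show "((\<lambda>e. c * ((v + e) - (u - e))) \<longlongrightarrow> c * (v - u)) (at_right 0)"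
      by (auto intro!: tendsto_eq_intros)
    have "((\<lambda>e. v + e) \<longlongrightarrow> v) (at_right 0)" "((\<lambda>e. u - e) \<longlongrightarrow> u) (at_right 0)" by (auto intro!: tendsto_eq_intros)
    then show "((\<lambda>e. Fn (v + e) - Fn (u - e)) \<longlongrightarrow> Fn v - Fn u) (at_right 0)"
      by (intro tendsto_diff isCont_tendsto_compose[OF isCont_Fn])
    have "\<forall>\<^sub>F e in at_right 0. e < (d - (v - u)) / 2"
      using uv unfolding eventually_at_right_field by (intro exI[of _ "(d - (v - u)) / 2"]) auto
    moreover have "\<forall>\<^sub>F e in at_right (0::real). 0 < e" by (rule eventually_at_right_less)
    ultimately show "\<forall>\<^sub>F e in at_right 0. c * ((v + e) - (u - e)) \<le> Fn (v + e) - Fn (u - e)"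
      by eventually_elim (use uv in \<open>intro 1, auto\<close>)
  qed auto
  with d show ?thesis by blast
qed

theorem AE_has_derivative: "AE x in lborel. (Fn has_real_derivative D x) (at x)"
proof -
  \<comment> \<open>Rational levels and integer cut-offs leave only countably many null sets to
    discard.\<close>
  have up: "AE x in lborel. \<forall>c\<in>\<rat>. \<forall>c'\<in>\<rat>. \<forall>n. 0 \<le> c' \<and> c' < c \<longrightarrow> x \<notin> {x. D x \<le> c'} \<inter> {-real n<..<real n} \<inter> fine_set (\<lambda>u v. ennreal (c * (v - u)) \<le> emeasure M {u..v})"
    using null_upper by (auto simp: AE_ball_countable AE_all_countable countable_rat intro!: AE_not_in simp del: Int_iff)
  have lo: "AE x in lborel. \<forall>c\<in>\<rat>. \<forall>c'\<in>\<rat>. \<forall>n. 0 \<le> c' \<and> c' < c \<longrightarrow> x \<notin> {x. c \<le> D x} \<inter> {-real n<..<real n} \<inter> fine_set (\<lambda>u v. emeasure M {u..v} \<le> ennreal (c' * (v - u)))"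
    using null_lower by (auto simp: AE_ball_countable AE_all_countable countable_rat intro!: AE_not_in simp del: Int_iff)
  show ?thesis
    using up lo
  proof eventually_elim
    case (elim x)
    obtain n where n: "\<bar>x\<bar> < real n" using reals_Archimedean2 by blast
    then have xn: "x \<in> {-real n<..<real n}" by auto
    show ?case
      unfolding DERIV_def LIM_eq
    proof (intro allI impI)
      fix e :: real assume e: "0 < e"
      \<comment> \<open>Two levels are inserted between \<open>D x\<close> and
        \<open>D x + e\<close>, since the null sets separate a bound \<open>c'\<close> on the
        density from a strictly larger slope \<open>c\<close>.\<close>
      obtain c' where c': "c' \<in> \<rat>" "D x < c'" "c' < D x + e / 2" using Rats_dense_in_real[of "D x" "D x + e / 2"] e by auto
      obtain c where c: "c \<in> \<rat>" "c' < c" "c < D x + e" using Rats_dense_in_real[of "c'" "D x + e"] c' e by auto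
      have "x \<notin> fine_set (\<lambda>u v. ennreal (c * (v - u)) \<le> emeasure M {u..v})"
        using elim(1)[rule_format, of c c' n] c c' xn D_nonneg[of x] by auto
      from slope_le[OF this] obtain d1 where d1: "d1 > 0" "\<And>u v. u \<le> x \<Longrightarrow> x \<le> v \<Longrightarrow> v - u < d1 \<Longrightarrow> Fn v - Fn u \<le> c * (v - u)"
        using c c' D_nonneg[of x] by force
      have "\<exists>d>0. \<forall>u v. u \<le> x \<longrightarrow> x \<le> v \<longrightarrow> v - u < d \<longrightarrow> (D x - e / 2) * (v - u) \<le> Fn v - Fn u"
      proof (cases "D x = 0")
        case True
        \<comment> \<open>The null sets for lower slopes concern nonnegative levels below
          \<open>D x\<close>, and none exists strictly between 0 and \<open>D x = 0\<close>.
          Monotonicity of the cdf gives the bound directly.\<close>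
        have "(D x - e / 2) * (v - u) \<le> Fn v - Fn u" if "u \<le> x" "x \<le> v" for u v
        proof -
          have "(D x - e / 2) * (v - u) \<le> 0" using that True e by (intro mult_nonpos_nonneg) auto
          also have "0 \<le> measure M {u..v}" by simp
          also have "\<dots> = Fn v - Fn u" using that by (intro measure_Icc) auto
          finally show ?thesis .
        qed
        then show ?thesis by (intro exI[of _ 1]) auto
      next
        case False
        then have pos: "D x > 0" using D_nonneg[of x] by auto
        obtain b where b: "b \<in> \<rat>" "max 0 (D x - e / 2) < b" "b < D x" using Rats_dense_in_real[of "max 0 (D x - e / 2)" "D x"] e pos by auto
        obtain b' where b': "b' \<in> \<rat>" "max 0 (D x - e / 2) < b'" "b' < b" using Rats_dense_in_real[of "max 0 (D x - e / 2)" b] b e by auto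
        have "x \<notin> fine_set (\<lambda>u v. emeasure M {u..v} \<le> ennreal (b' * (v - u)))"
          using elim(2)[rule_format, of b b' n] b b' xn by auto
        from slope_ge[OF this] obtain d where d: "d > 0" "\<And>u v. u \<le> x \<Longrightarrow> x \<le> v \<Longrightarrow> v - u < d \<Longrightarrow> b' * (v - u) \<le> Fn v - Fn u"
          using b' by force
        have "(D x - e / 2) * (v - u) \<le> Fn v - Fn u" if "u \<le> x" "x \<le> v" "v - u < d" for u v
        proof -
          have "(D x - e / 2) * (v - u) \<le> b' * (v - u)" using that b' by (intro mult_right_mono) auto
          with d(2)[OF that] show ?thesis by simp
        qed
        with d show ?thesis by blast
      qed
      then obtain d2 where d2: "d2 > 0" "\<And>u v. u \<le> x \<Longrightarrow> x \<le> v \<Longrightarrow> v - u < d2 \<Longrightarrow> (D x - e / 2) * (v - u) \<le> Fn v - Fn u"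
        by blast
      show "\<exists>s>0. \<forall>y. y \<noteq> 0 \<and> norm (y - 0) < s \<longrightarrow> norm ((Fn (x + y) - Fn x) / y - D x) < e"
      proof (intro exI[of _ "min d1 d2"] conjI allI impI)
        show "0 < min d1 d2" using d1 d2 by auto
        fix h :: real assume h: "h \<noteq> 0 \<and> norm (h - 0) < min d1 d2"
        have A: "(Fn (x + h) - Fn x) / h \<le> c \<and> D x - e / 2 \<le> (Fn (x + h) - Fn x) / h"
        proof (cases "h > 0")
          case True
          then show ?thesis using d1(2)[of x "x + h"] d2(2)[of x "x + h"] h by (auto simp: field_simps)
        next
          case False
          then show ?thesis using d1(2)[of "x + h" x] d2(2)[of "x + h" x] h by (auto simp: field_simps)
        qed
        then show "norm ((Fn (x + h) - Fn x) / h - D x) < e" using c e by (auto simp: abs_if)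
      qed
    qed
  qed
qed

end

section \<open>The cumulative hazard\<close>

locale ac_baseline = density_measure D M for D M +
  assumes prob_UNIV: "emeasure M UNIV = 1"
    and Fn_0: "cdf M 0 = 0"
begin

sublocale real_distribution M
  by unfold_locales (simp_all add: prob_UNIV)

lemma Fn_mono: "x \<le> y \<Longrightarrow> Fn x \<le> Fn y"
  by (rule cdf_nondecreasing)

lemma Fn_le_1: "Fn x \<le> 1" and Fn_nonneg: "0 \<le> Fn x"
  by (rule cdf_bounded_prob, rule cdf_nonneg)

lemma Fn_eq_0: "x \<le> 0 \<Longrightarrow> Fn x = 0"
  using Fn_mono[of x 0] Fn_nonneg[of x] Fn_0 by simp

lemma Fn_pos_imp: "0 < Fn x \<Longrightarrow> 0 < x"
  using Fn_eq_0[of x] by (cases "x \<le> 0") auto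

lemma Fn_less_imp: "Fn x < Fn y \<Longrightarrow> x < y"
  using Fn_mono[of y x] by (cases "x < y") auto

lemma Fn_borel [measurable]: "Fn \<in> borel_measurable borel"
  by (intro borel_measurable_mono monoI Fn_mono)

lemma Fn_surj:
  assumes "0 \<le> p" "p < 1"
  shows "\<exists>t\<ge>0. Fn t = p"
proof -
  have "eventually (\<lambda>t. p < Fn t) at_top"
    using cdf_lim_at_top_prob assms by (intro order_tendstoD) auto
  then obtain y where "p < Fn y" by (auto simp: eventually_at_top_linorder)
  moreover from this have "0 \<le> y" using Fn_pos_imp[of y] assms by auto
  ultimately show ?thesis
    using IVT[of Fn 0 p y] isCont_Fn assms by (auto simp: Fn_0)
qed

text \<open>Probability integral transform. It moves integrals of functions of \<open>Fn\<close> to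
  the unit interval, where the fundamental theorem of calculus applies although \<open>Fn\<close> is
  differentiable only almost everywhere.\<close>

lemma distributed_Fn: "distributed M lborel Fn (\<lambda>x. indicator {0..1} x / measure lborel {0..1::real})"
proof (rule uniform_distrI_borel_atLeastAtMost)
  fix p :: real assume p: "0 \<le> p" "p \<le> 1"
  show "\<P>(x in M. Fn x \<le> p) = (p - 0) / (1 - 0)"
  proof (cases "p = 1")
    case True
    then show ?thesis by (simp add: Fn_le_1 prob_space[unfolded space_M])
  next
    case False
    with p have p1: "p < 1" by simp
    have *: "prob {x. Fn x \<le> p} = Fn t \<or> Fn t < prob {x. Fn x \<le> p}" if "Fn t = p" for t
    proof -
      have "prob {..t} \<le> prob {x. Fn x \<le> p}"
        using that Fn_mono by (intro finite_measure_mono) (auto intro: order_trans)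
      then show ?thesis by (auto simp: cdf_def)
    qed
    obtain t where t: "Fn t = p" using Fn_surj[OF p(1) p1] by blast
    have "p \<le> prob {x. Fn x \<le> p}" using *[OF t] t by auto
    \<comment> \<open>The level set of \<open>p\<close> may be a whole interval, so its right end is
      not reached by a chosen \<open>t\<close>. Levels \<open>p'\<close> above \<open>p\<close> have
      their points \<open>s\<close> to the right of it, and \<open>p'\<close> can decrease to
      \<open>p\<close>.\<close>
    moreover have "prob {x. Fn x \<le> p} \<le> p'" if "p < p'" "p' < 1" for p'
    proof -
      have "0 \<le> p'" using that p by simp
      from Fn_surj[OF this that(2)] obtain s where s: "Fn s = p'" by blast
      have "prob {x. Fn x \<le> p} \<le> prob {..s}"
        using s that by (intro finite_measure_mono subsetI) (simp_all add: less_imp_le Fn_less_imp)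
      then show ?thesis using s by (simp add: cdf_def)
    qed
    then have "prob {x. Fn x \<le> p} \<le> p"
      using p1 by (intro dense_ge_bounded[of p 1]) auto
    ultimately show ?thesis by simp
  qed
qed auto

lemma nn_integral_Fn:
  assumes [measurable]: "g \<in> borel_measurable borel"
  shows "(\<integral>\<^sup>+x. g (Fn x) \<partial>M) = (\<integral>\<^sup>+u. indicator {0..1} u * g u \<partial>lborel)"
  using distributed_nn_integral[OF distributed_Fn, of g] by (simp add: ennreal_indicator)

lemma level_null: "emeasure M {x. Fn x = c} = 0"
proof -
  have "emeasure M {x. Fn x = c} = (\<integral>\<^sup>+x. indicator {c} (Fn x) \<partial>M)"
    using nn_integral_indicator[of "{x. Fn x = c}" M] by (simp add: indicator_def)
  also have "\<dots> = (\<integral>\<^sup>+u. indicator {0..1} u * indicator {c} u \<partial>lborel)"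
    by (rule nn_integral_Fn) simp
  also have "\<dots> \<le> (\<integral>\<^sup>+u. indicator {c} u \<partial>lborel)"
    by (intro nn_integral_mono) (auto split: split_indicator)
  also have "\<dots> = 0" by simp
  finally show ?thesis by simp
qed

text \<open>Where the cdf equals 1, division by zero makes \<open>lam\<close> vanish, which agrees
  with the default of \<open>hazard_rate\<close> to the right of the support. Likewise
  \<open>cumhaz\<close> is 0 there because \<open>ln 0 = 0\<close>, hence the condition
  \<open>Fn y < 1\<close> in the facts on it.\<close>

definition lam :: "real \<Rightarrow> real" where
  "lam s = D s / (1 - Fn s)"

definition cumhaz :: "real \<Rightarrow> real" where
  "cumhaz s = - ln (1 - Fn s)"

lemma lam_borel [measurable]: "lam \<in> borel_measurable borel"
  unfolding lam_def by measurable

lemma cumhaz_borel [measurable]: "cumhaz \<in> borel_measurable borel"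
  unfolding cumhaz_def by measurable

lemma lam_nonneg: "0 \<le> lam s"
  unfolding lam_def using D_nonneg[of s] Fn_le_1[of s] by simp

text \<open>The density \<open>D\<close> is absorbed into \<open>M\<close>: hazard is dF / (1 - F),
  an integrand in \<open>Fn\<close> ready for the transform to the unit interval.\<close>

lemma nn_integral_lam:
  assumes [measurable]: "g \<in> borel_measurable borel"
  shows "(\<integral>\<^sup>+v. ennreal (lam v) * g v \<partial>lborel) = (\<integral>\<^sup>+v. ennreal (1 / (1 - Fn v)) * g v \<partial>M)"
proof -
  have "(\<integral>\<^sup>+v. ennreal (1 / (1 - Fn v)) * g v \<partial>M) = (\<integral>\<^sup>+v. ennreal (D v) * (ennreal (1 / (1 - Fn v)) * g v) \<partial>lborel)"
    by (subst M_def, subst nn_integral_density) auto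
  also have "\<dots> = (\<integral>\<^sup>+v. ennreal (lam v) * g v \<partial>lborel)"
    using D_nonneg Fn_le_1
    by (intro nn_integral_cong) (simp add: lam_def ennreal_mult[symmetric] mult.assoc[symmetric])
  finally show ?thesis by simp
qed

text \<open>Level sets of the cdf are null for \<open>M\<close>, so they carry no hazard. This later
  keeps failures out of the intervals of constancy.\<close>

lemma AE_lam_level: "AE v in lborel. Fn v = c \<longrightarrow> lam v = 0"
proof -
  have "(\<integral>\<^sup>+v. ennreal (lam v) * indicator {v. Fn v = c} v \<partial>lborel)
      = (\<integral>\<^sup>+v. ennreal (1 / (1 - c)) * indicator {v. Fn v = c} v \<partial>M)"
    by (subst nn_integral_lam) (auto intro!: nn_integral_cong split: split_indicator)
  also have "\<dots> = 0" by (subst nn_integral_cmult_indicator) (auto simp: level_null)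
  finally have "AE v in lborel. ennreal (lam v) * indicator {v. Fn v = c} v = 0"
    by (subst (asm) nn_integral_0_iff_AE) auto
  then show ?thesis
    by eventually_elim (use lam_nonneg in \<open>auto simp: ennreal_eq_0_iff antisym split: split_indicator_asm\<close>)
qed

lemma nn_integral_lam_Ioc:
  assumes "x \<le> y" "Fn y < 1"
  shows "(\<integral>\<^sup>+v. ennreal (lam v) * indicator {x<..y} v \<partial>lborel) = ennreal (cumhaz y - cumhaz x)"
proof -
  \<comment> \<open>Away from these two null level sets, lying in \<open>{x<..y}\<close> is a
    condition on \<open>Fn v\<close> alone, so the integrand becomes a function of
    \<open>Fn\<close>.\<close>
  have ae: "AE v in M. Fn v \<noteq> Fn x \<and> Fn v \<noteq> Fn y"
    using level_null[of "Fn x"] level_null[of "Fn y"] by (intro AE_conjI) (auto simp: AE_iff_measurable[OF _ refl])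
  have "(\<integral>\<^sup>+v. ennreal (lam v) * indicator {x<..y} v \<partial>lborel)
      = (\<integral>\<^sup>+v. ennreal (1 / (1 - Fn v)) * indicator {x<..y} v \<partial>M)"
    by (rule nn_integral_lam) simp
  also have "\<dots> = (\<integral>\<^sup>+v. ennreal (1 / (1 - Fn v)) * indicator {Fn x..Fn y} (Fn v) \<partial>M)"
    by (rule nn_integral_cong_AE, use ae in eventually_elim)
      (smt (verit) Fn_mono atLeastAtMost_iff greaterThanAtMost_iff indicator_simps)
  also have "\<dots> = (\<integral>\<^sup>+u. indicator {0..1} u * (ennreal (1 / (1 - u)) * indicator {Fn x..Fn y} u) \<partial>lborel)"
    by (rule nn_integral_Fn[of "\<lambda>u. ennreal (1 / (1 - u)) * indicator {Fn x..Fn y} u"]) simp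
  also have "\<dots> = (\<integral>\<^sup>+u. ennreal (1 / (1 - u)) * indicator {Fn x..Fn y} u \<partial>lborel)"
    using Fn_nonneg[of x] Fn_le_1[of y] by (intro nn_integral_cong) (auto split: split_indicator)
  also have "\<dots> = ennreal (- ln (1 - Fn y) - - ln (1 - Fn x))"
    using assms Fn_mono[of x y]
    by (intro nn_integral_FTC_Icc) (auto intro!: derivative_eq_intros)
  finally show ?thesis by (simp add: cumhaz_def)
qed

lemma cumhaz_mono: "x \<le> y \<Longrightarrow> Fn y < 1 \<Longrightarrow> cumhaz x \<le> cumhaz y"
  using Fn_mono[of x y] by (simp add: cumhaz_def)

lemma Fn_eq_exp: "Fn y < 1 \<Longrightarrow> Fn y = 1 - exp (- cumhaz y)"
  by (simp add: cumhaz_def)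

text \<open>Contradicts a finite compensator; this is how failures at points with cdf 1 are excluded
  in \<open>AE_good\<close>.\<close>

lemma nn_integral_lam_infinite:
  assumes "Fn y = 1"
  shows "(\<integral>\<^sup>+v. ennreal (lam v) * indicator {0<..y} v \<partial>lborel) = \<infinity>"
proof (rule ccontr)
  assume "\<not> ?thesis"
  then obtain b where b: "(\<integral>\<^sup>+v. ennreal (lam v) * indicator {0<..y} v \<partial>lborel) = ennreal b" "0 \<le> b"
    by (cases "\<integral>\<^sup>+v. ennreal (lam v) * indicator {0<..y} v \<partial>lborel") auto
  \<comment> \<open>At this level \<open>cumhaz t = b + 1\<close>, which exceeds the supposed total
    hazard \<open>b\<close>.\<close>
  obtain t where t: "0 \<le> t" "Fn t = 1 - exp (- (b + 1))" using Fn_surj[of "1 - exp (- (b + 1))"] b by auto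
  have "Fn t < Fn y" unfolding t(2) assms by simp
  then have "t < y" by (rule Fn_less_imp)
  have "ennreal (b + 1) = ennreal (cumhaz t - cumhaz 0)" using t by (simp add: cumhaz_def Fn_0 add.commute)
  also have "\<dots> = (\<integral>\<^sup>+v. ennreal (lam v) * indicator {0<..t} v \<partial>lborel)"
    using t by (intro nn_integral_lam_Ioc[symmetric]) auto
  also have "\<dots> \<le> (\<integral>\<^sup>+v. ennreal (lam v) * indicator {0<..y} v \<partial>lborel)"
    using \<open>t < y\<close> by (intro nn_integral_mono) (auto split: split_indicator)
  finally show False using b by simp
qed

text \<open>Since \<open>ennreal\<close> sends negative numbers to 0, the right side is a positive
  part: the hazard collected after the first \<open>u\<close> units since \<open>x\<close> have been
  used up.\<close>

lemma nn_integral_lam_excess: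
  assumes x: "x \<le> y" "Fn y < 1" and u: "0 \<le> u"
  shows "(\<integral>\<^sup>+v. ennreal (lam v) * indicator {v. x < v \<and> v \<le> y \<and> u < cumhaz v - cumhaz x} v \<partial>lborel)
    = ennreal (cumhaz y - cumhaz x - u)"
proof (cases "u < cumhaz y - cumhaz x")
  case True
  have Fx: "Fn x < 1" using Fn_mono[OF x(1)] x by simp
  \<comment> \<open>The level at which the cumulative hazard has grown by exactly \<open>u\<close>
    since \<open>x\<close>.\<close>
  define p where "p = 1 - exp (- (cumhaz x + u))"
  have p: "Fn x \<le> p" "p < Fn y"
    using True Fx x u unfolding p_def by (auto simp: Fn_eq_exp)
  then obtain z where z: "Fn z = p" "x \<le> z" "z \<le> y"
    using IVT[of Fn x p y] isCont_Fn x by auto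
  have Hz: "cumhaz z = cumhaz x + u" using z by (simp add: cumhaz_def[of z] p_def)
  have "(\<integral>\<^sup>+v. ennreal (lam v) * indicator {v. x < v \<and> v \<le> y \<and> u < cumhaz v - cumhaz x} v \<partial>lborel)
      = (\<integral>\<^sup>+v. ennreal (lam v) * indicator {z<..y} v \<partial>lborel)"
    using AE_lam_level[of p]
  proof (intro nn_integral_cong_AE, eventually_elim)
    case (elim v)
    have "u < cumhaz v - cumhaz x \<longleftrightarrow> z < v" if "v \<le> y" "Fn v \<noteq> p"
    proof -
      have Fv: "Fn v < 1" using Fn_mono[OF that(1)] x by simp
      have "u < cumhaz v - cumhaz x \<longleftrightarrow> cumhaz z < cumhaz v" using Hz by auto
      also have "\<dots> \<longleftrightarrow> Fn z < Fn v"
        using Fv z p x by (simp add: cumhaz_def)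
      also have "\<dots> \<longleftrightarrow> z < v"
        using Fn_less_imp[of z v] Fn_mono[of z v] that z by auto
      finally show ?thesis .
    qed
    then show ?case using elim z by (auto split: split_indicator)
  qed
  also have "\<dots> = ennreal (cumhaz y - cumhaz z)"
    using z x by (intro nn_integral_lam_Ioc) auto
  finally show ?thesis by (simp add: Hz algebra_simps)
next
  case False
  have "(\<integral>\<^sup>+v. ennreal (lam v) * indicator {v. x < v \<and> v \<le> y \<and> u < cumhaz v - cumhaz x} v \<partial>lborel) = 0"
    using False cumhaz_mono[of _ y] x by (intro nn_integral_zero') (fastforce split: split_indicator)
  with False show ?thesis by (simp add: ennreal_neg)
qed

lemma cumhaz_0: "cumhaz 0 = 0"
  by (simp add: cumhaz_def Fn_0)

text \<open>Negative thresholds impose nothing, by monotonicity of \<open>cumhaz\<close>. They are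
  kept because \<open>exponential_survival\<close> reads off the mass of the past event at threshold
  -1.\<close>

lemma nn_integral_lam_excess':
  assumes x: "x \<le> y" "Fn y < 1"
  shows "(\<integral>\<^sup>+v. ennreal (lam v) * indicator {v. x < v \<and> v \<le> y \<and> u < cumhaz v - cumhaz x} v \<partial>lborel)
    = ennreal (cumhaz y - cumhaz x - max 0 u)"
proof (cases "0 \<le> u")
  case False
  have "{v. x < v \<and> v \<le> y \<and> u < cumhaz v - cumhaz x} = {x<..y}"
  proof (intro equalityI subsetI)
    fix v assume v: "v \<in> {x<..y}"
    then have "Fn v < 1" using Fn_mono[of v y] x by simp
    with v False show "v \<in> {v. x < v \<and> v \<le> y \<and> u < cumhaz v - cumhaz x}"
      using cumhaz_mono[of x v] by simp
  qed auto
  with False show ?thesis using nn_integral_lam_Ioc[OF x] by simp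
qed (simp add: nn_integral_lam_excess x)

lemma AE_hazard_rate: "AE s in lborel. hazard_rate Fn s = lam s"
proof -
  \<comment> \<open>At most one point, the leftmost one with cdf 1. To the right of it
    \<open>ln (1 - Fn s)\<close> is locally the constant \<open>ln 0 = 0\<close>; to the left of it
    the cdf is below 1 and the chain rule applies.\<close>
  let ?Z = "{s. Fn s = 1 \<and> (\<forall>s'<s. Fn s' \<noteq> 1)}"
  have "AE s in lborel. s \<notin> ?Z"
  proof (cases "?Z = {}")
    case False
    then obtain b where b: "b \<in> ?Z" by blast
    have "x = b" if "x \<in> ?Z" for x
      using that b by (cases x b rule: linorder_cases) auto
    then have "?Z \<subseteq> {b}" by blast
    have *: "AE s in lborel. s \<noteq> b" by (rule AE_lborel_singleton)
    show ?thesis using * by (rule AE_mp) (use \<open>?Z \<subseteq> {b}\<close> in \<open>intro AE_I2 impI notI, blast\<close>)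
  qed simp
  with AE_has_derivative show ?thesis
  proof eventually_elim
    case (elim s)
    show ?case
    proof (cases "Fn s = 1")
      case True
      with elim obtain s' where s': "s' < s" "Fn s' = 1" by blast
      have eq: "Fn y = 1" if "y \<in> {s'<..}" for y
        using Fn_mono[of s' y] Fn_le_1[of y] s' that by auto
      have "((\<lambda>s. ln (1 - Fn s)) has_real_derivative 0) (at s)"
        by (rule has_field_derivative_transform_within_open[of "\<lambda>_. 0" _ _ "{s'<..}"]) (use s' eq in auto)
      then show ?thesis by (simp add: hazard_rate_def DERIV_imp_deriv lam_def True)
    next
      case False
      then have "Fn s < 1" using Fn_le_1[of s] by simp
      then have "((\<lambda>s. ln (1 - Fn s)) has_real_derivative - lam s) (at s)"
        using elim by (auto intro!: derivative_eq_intros simp: lam_def)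
      then show ?thesis by (simp add: hazard_rate_def DERIV_imp_deriv)
    qed
  qed
qed

end

lemma ac_cdfs_baseline:
  assumes "F \<in> ac_cdfs"
  obtains D M where "ac_baseline D M" "F = cdf M"
proof -
  from assms obtain \<mu> where mu: "real_distribution \<mu>" "absolutely_continuous lborel \<mu>" "cdf \<mu> 0 = 0" "F = cdf \<mu>"
    unfolding ac_cdfs_def by auto
  interpret real_distribution \<mu> by fact
  obtain D where D: "D \<in> borel_measurable lborel" "AE x in lborel. RN_deriv lborel \<mu> x = ennreal (D x)" "\<And>x. 0 \<le> D x"
    using sigma_finite_measure.real_RN_deriv[OF lborel.sigma_finite_measure_axioms finite_measure_axioms mu(2)] by auto
  have "density lborel (\<lambda>x. ennreal (D x)) = density lborel (RN_deriv lborel \<mu>)"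
    using D by (intro density_cong) auto
  also have "\<dots> = \<mu>" using mu by (intro sigma_finite_measure.density_RN_deriv lborel.sigma_finite_measure_axioms) auto
  finally have "\<mu> = density lborel (\<lambda>x. ennreal (D x))" ..
  then have "ac_baseline D \<mu>"
    using D mu finite_measure_axioms emeasure_space_1 by unfold_locales (auto simp: finite_measure_def)
  then show ?thesis using mu that by blast
qed

section \<open>Laws determined by survival functions\<close>

text \<open>With p(u) the probability on the left, the equation says that p(u) is \<open>g\<close>
  times the integral of p over (u, infinity). Instead of differentiating, p is squeezed: one step of
  length \<open>h\<close> multiplies it by a factor between 1 - gh and 1/(1 + gh), and n steps of
  length u/n give the exponential in the limit.\<close>

lemma (in prob_space) exponential_survival:
  fixes Z :: "'a \<Rightarrow> real"
  assumes [measurable]: "B \<in> sets M" "Z \<in> borel_measurable M"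
    and Z: "AE x in M. 0 \<le> Z x" and g: "0 < g"
    and eq: "\<And>u. emeasure M {x \<in> B. u < Z x} =
      ennreal g * (\<integral>\<^sup>+x. indicator B x * ennreal (Z x - max 0 u) \<partial>M)"
    and u: "0 \<le> u"
  shows "measure M {x \<in> B. u < Z x} = exp (- (g * u)) * measure M B"
proof -
  define p where "p = (\<lambda>u. measure M {x \<in> B. u < Z x})"
  have [measurable]: "{x \<in> B. u < Z x} \<in> sets M" for u
  proof -
    have "{x \<in> B. u < Z x} = B \<inter> {x \<in> space M. u < Z x}" using sets.sets_into_space[of B M] by auto
    then show ?thesis by simp
  qed
  have p: "emeasure M {x \<in> B. u < Z x} = ennreal (p u)" for u by (simp add: p_def emeasure_eq_measure)
  have p0 [simp]: "0 \<le> p u" for u by (simp add: p_def)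
  have ind: "indicator B x * indicator {x. u < Z x} x = (indicator {x \<in> B. u < Z x} x :: ennreal)" for u x
    by (auto split: split_indicator)
  have nn: "(\<integral>\<^sup>+x. indicator B x * (ennreal h * indicator {x. u < Z x} x) \<partial>M) = ennreal h * ennreal (p u)" for h u
    unfolding p[symmetric] by (subst mult.left_commute, subst ind, subst nn_integral_cmult_indicator) auto
  \<comment> \<open>Both bounds integrate the pointwise estimate: (Z - u)^+ is at least (Z - u -
    h)^+ plus h on the event Z > u + h, and at most (Z - u - h)^+ plus h on the event Z > u.\<close>
  have step: "p (u + h) * (1 + g * h) \<le> p u" "p u * (1 - g * h) \<le> p (u + h)" if "0 \<le> u" "0 \<le> h" for u h
  proof -
    let ?I = "\<lambda>u. \<integral>\<^sup>+x. indicator B x * ennreal (Z x - u) \<partial>M"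
    have pI: "ennreal (p u) = ennreal g * ?I u" if "0 \<le> u" for u using eq[of u] that by (simp add: p)
    have "?I (u + h) + ennreal h * ennreal (p (u + h)) = (\<integral>\<^sup>+x. indicator B x * ennreal (Z x - (u + h)) + indicator B x * (ennreal h * indicator {x. u + h < Z x} x) \<partial>M)"
      by (subst nn_integral_add) (simp_all add: nn)
    also have "\<dots> \<le> ?I u"
      using that by (intro nn_integral_mono) (auto simp: ennreal_plus[symmetric] simp del: ennreal_plus split: split_indicator intro!: ennreal_leI)
    finally have "ennreal g * (?I (u + h) + ennreal h * ennreal (p (u + h))) \<le> ennreal g * ?I u"
      by (rule mult_left_mono) simp
    then have "ennreal (p (u + h)) + ennreal (g * (h * p (u + h))) \<le> ennreal (p u)"
      using pI[of u] pI[of "u + h"] that g by (simp add: distrib_left ennreal_mult)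
    then show "p (u + h) * (1 + g * h) \<le> p u"
      using that g by (simp add: ennreal_plus[symmetric] algebra_simps del: ennreal_plus)
    have "?I u \<le> (\<integral>\<^sup>+x. indicator B x * ennreal (Z x - (u + h)) + indicator B x * (ennreal h * indicator {x. u < Z x} x) \<partial>M)"
      using that by (intro nn_integral_mono) (auto simp: ennreal_plus_if[symmetric] ennreal_plus_if ennreal_neg split: split_indicator intro!: ennreal_leI)
    also have "\<dots> = ?I (u + h) + ennreal h * ennreal (p u)"
      by (subst nn_integral_add) (simp_all add: nn)
    finally have "ennreal g * ?I u \<le> ennreal g * (?I (u + h) + ennreal h * ennreal (p u))"
      by (rule mult_left_mono) simp
    then have "ennreal (p u) \<le> ennreal (p (u + h)) + ennreal (g * (h * p u))"
      using pI[of u] pI[of "u + h"] that g by (simp add: distrib_left ennreal_mult)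
    then show "p u * (1 - g * h) \<le> p (u + h)"
      using that g by (simp add: ennreal_plus[symmetric] algebra_simps del: ennreal_plus)
  qed
  have upper: "p (real k * h) * (1 + g * h) ^ k \<le> p 0" if "0 \<le> h" for k h
  proof (induction k)
    case (Suc k)
    have "p (real (Suc k) * h) * (1 + g * h) ^ Suc k = (p (real k * h + h) * (1 + g * h)) * (1 + g * h) ^ k"
      by (simp add: algebra_simps)
    also have "\<dots> \<le> p (real k * h) * (1 + g * h) ^ k"
      using step(1)[of "real k * h" h] that g by (intro mult_right_mono) auto
    finally show ?case using Suc by simp
  qed simp
  have lower: "p 0 * (1 - g * h) ^ k \<le> p (real k * h)" if "0 \<le> h" "g * h \<le> 1" for k h
  proof (induction k)
    case (Suc k)
    have "p 0 * (1 - g * h) ^ Suc k = (p 0 * (1 - g * h) ^ k) * (1 - g * h)" by (simp add: algebra_simps)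
    also have "\<dots> \<le> p (real k * h) * (1 - g * h)" using Suc that by (intro mult_right_mono) auto
    also have "\<dots> \<le> p (real k * h + h)" using step(2)[of "real k * h" h] that by simp
    finally show ?case by (simp add: algebra_simps)
  qed simp
  \<comment> \<open>The equation has the same right side at the thresholds -1 and 0, and at -1 the
    event is all of \<open>B\<close> up to a null set. So \<open>Z\<close> has no atom at 0 within
    \<open>B\<close>.\<close>
  have "p 0 = measure M B"
  proof -
    have "emeasure M B = emeasure M {x \<in> B. -1 < Z x}"
      using Z by (intro emeasure_eq_AE) auto
    also have "\<dots> = emeasure M {x \<in> B. 0 < Z x}" using eq[of "-1"] eq[of 0] by simp
    finally show ?thesis by (simp add: p_def measure_def)
  qed
  moreover have "p u = exp (- (g * u)) * p 0"
  proof (rule antisym)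
    have "(\<lambda>n. p u * (1 + g * u / real n) ^ n) \<longlonglongrightarrow> p u * exp (g * u)"
      by (intro tendsto_intros tendsto_exp_limit_sequentially)
    moreover have "\<forall>\<^sub>F n in sequentially. p u * (1 + g * u / real n) ^ n \<le> p 0"
      using eventually_gt_at_top[of 0]
    proof eventually_elim
      case (elim n)
      then show ?case using upper[of "u / real n" n] u by simp
    qed
    ultimately have "p u * exp (g * u) \<le> p 0"
      by (rule tendsto_upperbound) simp
    then show "p u \<le> exp (- (g * u)) * p 0" by (simp add: exp_minus field_simps)
    have "(\<lambda>n. p 0 * (1 + (- (g * u)) / real n) ^ n) \<longlonglongrightarrow> p 0 * exp (- (g * u))"
      by (intro tendsto_intros tendsto_exp_limit_sequentially)
    moreover have "\<forall>\<^sub>F n in sequentially. p 0 * (1 + (- (g * u)) / real n) ^ n \<le> p u"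
      using eventually_gt_at_top[of "nat \<lceil>g * u\<rceil>"] eventually_gt_at_top[of 0]
    proof eventually_elim
      case (elim n)
      then have "g * (u / real n) \<le> 1" by (simp add: field_simps) linarith
      from lower[OF _ this, of n] show ?case using elim u by simp
    qed
    ultimately have "p 0 * exp (- (g * u)) \<le> p u"
      by (rule tendsto_upperbound) simp
    then show "exp (- (g * u)) * p 0 \<le> p u" by (simp add: mult.commute)
  qed
  ultimately show ?thesis by (simp add: p_def)
qed

text \<open>Open upper orthants are closed under intersection and generate the product
  sigma-algebra, so two probability laws that agree on them coincide.\<close>

lemma joint_survival_determines_law:
  fixes V W :: "_ \<Rightarrow> nat \<Rightarrow> real"
  assumes P: "prob_space P" and Q: "prob_space Q" and I: "finite I"
    and V [measurable]: "\<And>i. i \<in> I \<Longrightarrow> (\<lambda>\<omega>. V \<omega> i) \<in> borel_measurable P"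
    and W [measurable]: "\<And>i. i \<in> I \<Longrightarrow> (\<lambda>\<omega>. W \<omega> i) \<in> borel_measurable Q"
    and eq: "\<And>u. measure P {\<omega> \<in> space P. \<forall>i\<in>I. u i < V \<omega> i} = measure Q {\<omega> \<in> space Q. \<forall>i\<in>I. u i < W \<omega> i}"
  shows "distr P (PiM I (\<lambda>_. borel)) (\<lambda>\<omega>. restrict (V \<omega>) I) = distr Q (PiM I (\<lambda>_. borel)) (\<lambda>\<omega>. restrict (W \<omega>) I)"
proof -
  interpret P: prob_space P by fact
  interpret Q: prob_space Q by fact
  define E where "E = {PiE I F | F. \<forall>i\<in>I. F i \<in> range (\<lambda>a::real. {a<..})}"
  define S where "S = (\<lambda>n::nat. {- real n<..})"
  have VM: "(\<lambda>\<omega>. restrict (V \<omega>) I) \<in> measurable P (PiM I (\<lambda>_. borel))" by measurable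
  have WM: "(\<lambda>\<omega>. restrict (W \<omega>) I) \<in> measurable Q (PiM I (\<lambda>_. borel))" by measurable
  have US: "(\<Union>n. S n) = UNIV"
    unfolding S_def by (auto simp: ) (metis minus_less_iff reals_Archimedean2)
  have sets: "sets (PiM I (\<lambda>_. borel :: real measure)) = sigma_sets (\<Pi>\<^sub>E i\<in>I. UNIV) E"
  proof -
    have "\<exists>S'\<subseteq>range greaterThan. countable S' \<and> (UNIV :: real set) = \<Union>S'"
      using US by (intro exI[of _ "range S"]) (auto simp: S_def)
    then have "sets (PiM I (\<lambda>_. borel :: real measure)) =
        sets (sigma (\<Pi>\<^sub>E i\<in>I. UNIV) {{f \<in> (\<Pi>\<^sub>E i\<in>I. UNIV). \<forall>i\<in>j. f i \<in> A i} | A j. j \<in> {I} \<and> A \<in> Pi j (\<lambda>_. range greaterThan)})"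
      unfolding borel_Ioi using I by (intro sets_PiM_sigma) auto
    also have "{{f \<in> (\<Pi>\<^sub>E i\<in>I. UNIV). \<forall>i\<in>j. f i \<in> A i} | A j. j \<in> {I} \<and> A \<in> Pi j (\<lambda>_. range greaterThan)} = E"
    proof -
      have "{f \<in> (\<Pi>\<^sub>E i\<in>I. UNIV). \<forall>i\<in>I. f i \<in> A i} = PiE I A" for A :: "nat \<Rightarrow> real set"
        by (auto simp: PiE_iff extensional_def)
      then show ?thesis by (auto simp: E_def Pi_iff)
    qed
    also have "sets (sigma (\<Pi>\<^sub>E i\<in>I. UNIV) E) = sigma_sets (\<Pi>\<^sub>E i\<in>I. UNIV) E"
      by (intro sets_measure_of) (auto simp: E_def PiE_iff)
    finally show ?thesis .
  qed
  show ?thesis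
  proof (rule measure_eqI_generator_eq[where E=E and \<Omega>="\<Pi>\<^sub>E i\<in>I. UNIV" and A="\<lambda>n. \<Pi>\<^sub>E i\<in>I. S n"])
    show "Int_stable E"
    proof (rule Int_stableI)
      fix a b assume "a \<in> E" "b \<in> E"
      then obtain F G where F: "a = PiE I F" "\<And>i. i \<in> I \<Longrightarrow> F i \<in> range (\<lambda>a. {a<..})"
        and G: "b = PiE I G" "\<And>i. i \<in> I \<Longrightarrow> G i \<in> range (\<lambda>a. {a<..})" by (auto simp: E_def)
      have "{x<..} \<inter> {y<..} = {max x y<..}" for x y :: real by auto
      then have "F i \<inter> G i \<in> range (\<lambda>a. {a<..})" if "i \<in> I" for i using F(2)[OF that] G(2)[OF that] by force
      then show "a \<inter> b \<in> E" unfolding E_def F G PiE_Int by blast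
    qed
    show "E \<subseteq> Pow (\<Pi>\<^sub>E i\<in>I. UNIV)" by (auto simp: E_def PiE_iff)
    show "range (\<lambda>n. \<Pi>\<^sub>E i\<in>I. S n) \<subseteq> E" by (auto simp: E_def S_def)
    show "(\<Union>n. \<Pi>\<^sub>E i\<in>I. S n) = (\<Pi>\<^sub>E i\<in>I. UNIV)"
    proof (intro equalityI subsetI)
      fix f :: "nat \<Rightarrow> real" assume f: "f \<in> (\<Pi>\<^sub>E i\<in>I. UNIV)"
      obtain n where n: "Max (insert 0 ((\<lambda>i. - f i) ` I)) < real n" using reals_Archimedean2 by blast
      have "- f i < real n" if "i \<in> I" for i
        using n I that by (subst (asm) Max_less_iff) auto
      then have "f \<in> (\<Pi>\<^sub>E i\<in>I. S n)" using f by (force simp: S_def PiE_iff)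
      then show "f \<in> (\<Union>n. \<Pi>\<^sub>E i\<in>I. S n)" by blast
    qed (auto simp: PiE_iff)
    show "emeasure (distr P (PiM I (\<lambda>_. borel)) (\<lambda>\<omega>. restrict (V \<omega>) I)) (\<Pi>\<^sub>E i\<in>I. S n) \<noteq> \<infinity>" for n
    proof -
      interpret D: prob_space "distr P (PiM I (\<lambda>_. borel)) (\<lambda>\<omega>. restrict (V \<omega>) I)"
        by (rule P.prob_space_distr[OF VM])
      show ?thesis using D.emeasure_finite by simp
    qed
    fix X assume "X \<in> E"
    then obtain F where F: "X = PiE I F" "\<forall>i\<in>I. F i \<in> range (\<lambda>a. {a<..})" by (auto simp: E_def)
    from F(2) have "\<exists>u. \<forall>i\<in>I. F i = {u i<..}" by (intro bchoice) auto
    then obtain u where u: "\<And>i. i \<in> I \<Longrightarrow> F i = {u i<..}" by blast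
    have X: "X \<in> sets (PiM I (\<lambda>_. borel))" unfolding F using u I by (intro sets_PiM_I_finite) auto
    have "(\<lambda>\<omega>. restrict (V \<omega>) I) -` X \<inter> space P = {\<omega> \<in> space P. \<forall>i\<in>I. u i < V \<omega> i}"
      using u by (auto simp: F PiE_iff)
    moreover have "(\<lambda>\<omega>. restrict (W \<omega>) I) -` X \<inter> space Q = {\<omega> \<in> space Q. \<forall>i\<in>I. u i < W \<omega> i}"
      using u by (auto simp: F PiE_iff)
    ultimately show "emeasure (distr P (PiM I (\<lambda>_. borel)) (\<lambda>\<omega>. restrict (V \<omega>) I)) X = emeasure (distr Q (PiM I (\<lambda>_. borel)) (\<lambda>\<omega>. restrict (W \<omega>) I)) X"
      using X VM WM eq[of u] by (simp add: emeasure_distr P.emeasure_eq_measure Q.emeasure_eq_measure)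
  qed (auto simp: sets)
qed

section \<open>From the compensator to the law of the spacings\<close>

lemma measurable_sum_of_bool [measurable (raw)]:
  assumes "finite I" "\<And>j. j \<in> I \<Longrightarrow> Measurable.pred M (Q j)"
  shows "(\<lambda>x. \<Sum>j\<in>I. of_bool (Q j x) :: nat) \<in> measurable M (count_space UNIV)"
  using assms
proof (induction I rule: finite_induct)
  case (insert i I)
  have [measurable]: "(\<lambda>x. \<Sum>j\<in>I. of_bool (Q j x) :: nat) \<in> measurable M (count_space UNIV)" "Measurable.pred M (Q i)"
    using insert by auto
  have "(\<lambda>x. of_bool (Q i x) + (\<Sum>j\<in>I. of_bool (Q j x)) :: nat) = (\<lambda>x. if Q i x then Suc (\<Sum>j\<in>I. of_bool (Q j x)) else (\<Sum>j\<in>I. of_bool (Q j x)))"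
    by auto
  then show ?case
    unfolding sum.insert[OF insert.hyps] by simp
qed simp

lemma failures_measurable [measurable (raw)]:
  assumes [measurable]: "\<And>j. j \<in> {1..r} \<Longrightarrow> (\<lambda>\<omega>. x \<omega> j) \<in> borel_measurable M" "t \<in> borel_measurable M"
  shows "(\<lambda>\<omega>. failures r (x \<omega>) (t \<omega>)) \<in> measurable M (count_space UNIV)"
    and "(\<lambda>\<omega>. failures_before r (x \<omega>) (t \<omega>)) \<in> measurable M (count_space UNIV)"
  unfolding failures_def failures_before_def by (rule measurable_sum_of_bool; measurable)+

lemma failures_le: "failures r x t \<le> r"
  unfolding failures_def
  using sum_bounded_above[of "{1..r}" "\<lambda>j. of_bool (x j \<le> t)" "1::nat"] by auto

lemma failures_mono: "s \<le> t \<Longrightarrow> failures r x s \<le> failures r x t"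
  unfolding failures_def by (intro sum_mono) auto

text \<open>The indices satisfying a downward closed \<open>Q\<close> form an initial segment. For
  ordered failure times this turns a condition on the count into a comparison with a single failure
  time.\<close>

lemma sum_of_bool_ge_iff:
  assumes down: "\<And>j k. j \<in> {1..r} \<Longrightarrow> k \<in> {1..r} \<Longrightarrow> j < k \<Longrightarrow> Q k \<Longrightarrow> Q j" and i: "i \<in> {1..r::nat}"
  shows "i \<le> (\<Sum>j=1..r. of_bool (Q j)) \<longleftrightarrow> Q i"
proof -
  have card: "(\<Sum>j=1..r. of_bool (Q j)) = card ({1..r} \<inter> {j. Q j})" by simp
  show ?thesis
  proof
    assume "Q i"
    then have "{1..i} \<subseteq> {1..r} \<inter> {j. Q j}"
      using down[of _ i] i by (auto simp: le_less)
    then have "card {1..i} \<le> card ({1..r} \<inter> {j. Q j})" by (intro card_mono) auto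
    then show "i \<le> (\<Sum>j=1..r. of_bool (Q j))" unfolding card by simp
  next
    assume le: "i \<le> (\<Sum>j=1..r. of_bool (Q j))"
    show "Q i"
    proof (rule ccontr)
      assume "\<not> Q i"
      then have "{1..r} \<inter> {j. Q j} \<subseteq> {1..<i}"
        using down[of i] i by (metis (no_types, lifting) IntE atLeastAtMost_iff atLeastLessThan_iff linorder_less_linear mem_Collect_eq subsetI)
      then have "card ({1..r} \<inter> {j. Q j}) \<le> card {1..<i}" by (intro card_mono) auto
      with le i show False unfolding card by auto
    qed
  qed
qed

section \<open>The counting process, its filtration and its compensator\<close>

locale sos_process = ac_baseline D M + P: prob_space P
  for D M and P :: "'a measure" +
  fixes r :: nat and \<gamma> :: "nat \<Rightarrow> real" and X :: "nat \<Rightarrow> 'a \<Rightarrow> real"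
  assumes gamma_pos: "\<And>j. j \<in> {1..r} \<Longrightarrow> 0 < \<gamma> j"
    and sos: "sequential_order_statistics P r \<gamma> (cdf M) X"
begin

lemma X_meas [measurable]: "j \<in> {1..r} \<Longrightarrow> X j \<in> borel_measurable P"
  using sos by (simp add: sequential_order_statistics_def)

definition cnt :: "real \<Rightarrow> 'a \<Rightarrow> real" where
  "cnt t \<omega> = real (failures r (\<lambda>j. X j \<omega>) t)"

definition rate :: "'a \<Rightarrow> real \<Rightarrow> real" where
  "rate \<omega> v = zero_ext r \<gamma> (failures_before r (\<lambda>j. X j \<omega>) v + 1)"

definition Lam :: "real \<Rightarrow> 'a \<Rightarrow> real" where
  "Lam t \<omega> = (LBINT s:{0..t}. sos_intensity r \<gamma> (cdf M) (\<lambda>j. X j \<omega>) s)"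

abbreviation Fl :: "real \<Rightarrow> 'a measure" where
  "Fl \<equiv> generated_filtration P cnt"

text \<open>Increment of the compensator as an extended nonnegative integral with \<open>lam\<close>
  in place of \<open>hazard_rate\<close>. It is meaningful on every path and fits the product
  measure \<open>comps\<close>.\<close>

definition dcomp :: "'a \<Rightarrow> real \<Rightarrow> real \<Rightarrow> ennreal" where
  "dcomp \<omega> s t = (\<integral>\<^sup>+v. indicator {s<..t} v * (ennreal (lam v) * ennreal (rate \<omega> v)) \<partial>lborel)"

lemma mart: "martingale P Fl (\<lambda>t \<omega>. cnt t \<omega> - Lam t \<omega>)"
  using sos by (simp add: sequential_order_statistics_def Let_def cnt_def[abs_def] Lam_def[abs_def])

lemma AE_intensity_integrable:
  "AE \<omega> in P. \<forall>t\<ge>0. set_integrable lborel {0..t} (sos_intensity r \<gamma> (cdf M) (\<lambda>j. X j \<omega>))"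
  using sos by (simp add: sequential_order_statistics_def)

lemma cnt_meas [measurable]: "cnt t \<in> borel_measurable P"
  unfolding cnt_def by measurable

lemma cnt_mono: "s \<le> t \<Longrightarrow> cnt s \<omega> \<le> cnt t \<omega>"
  unfolding cnt_def by (simp add: failures_mono)

lemma cnt_integrable: "integrable P (cnt t)"
  by (rule P.integrable_const_bound[of _ "real r"]) (auto simp: cnt_def failures_le)

lemma rate_nonneg: "0 \<le> rate \<omega> v"
  using gamma_pos by (auto simp: rate_def zero_ext_def less_imp_le)

lemma rate_meas [measurable]: "(\<lambda>(\<omega>, v). rate \<omega> v) \<in> borel_measurable (P \<Otimes>\<^sub>M borel)"
proof -
  have *: "zero_ext r \<gamma> \<in> measurable (count_space UNIV) borel" by simp
  have "(\<lambda>z. failures_before r (\<lambda>j. X j (fst z)) (snd z) + 1) \<in> measurable (P \<Otimes>\<^sub>M borel) (count_space UNIV)"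
    by measurable
  from measurable_compose[OF this *] show ?thesis by (simp add: rate_def split_beta')
qed

lemma rate_meas' [measurable]: "\<omega> \<in> space P \<Longrightarrow> rate \<omega> \<in> borel_measurable borel"
  using measurable_Pair2[OF rate_meas, of \<omega>] by simp

lemma sets_Fl: "sets (Fl t) = sigma_sets (space P) {cnt s -` B \<inter> space P | s B. 0 \<le> s \<and> s \<le> t \<and> B \<in> sets borel}"
  and space_Fl: "space (Fl t) = space P"
  unfolding generated_filtration_def by (intro sets_measure_of space_measure_of, blast)+

lemma Fl_subset: "sets (Fl t) \<subseteq> sets P"
  unfolding sets_Fl by (intro sets.sigma_sets_subset) auto

lemma Fl_mono: "s \<le> t \<Longrightarrow> sets (Fl s) \<subseteq> sets (Fl t)"
  unfolding sets_Fl by (intro sigma_sets_mono') force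

lemma cnt_Fl: "0 \<le> s \<Longrightarrow> B \<in> sets borel \<Longrightarrow> cnt s -` B \<inter> space P \<in> sets (Fl s)"
  unfolding sets_Fl by (intro sigma_sets.Basic) auto

lemma subalg: "subalgebra P (Fl t)"
  unfolding subalgebra_def using Fl_subset by (simp add: space_Fl)

text \<open>Path-wise integrability of the intensity is what identifies the Lebesgue integral in
  \<open>Lam\<close> with the extended nonnegative one.\<close>

lemma AE_comp:
  "AE \<omega> in P. \<forall>t\<ge>0. 0 \<le> Lam t \<omega> \<and> ennreal (Lam t \<omega>) = dcomp \<omega> 0 t"
  using AE_intensity_integrable AE_space
proof eventually_elim
  case (elim \<omega>)
  note [measurable] = rate_meas'[OF elim(2)]
  show ?case
  proof (intro allI impI)
    fix t :: real assume t: "0 \<le> t"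
    let ?I = "\<lambda>v. indicator {0..t} v *\<^sub>R sos_intensity r \<gamma> (cdf M) (\<lambda>j. X j \<omega>) v"
    have int: "integrable lborel ?I" using elim t by (simp add: set_integrable_def)
    have eq: "AE v in lborel. ?I v = indicator {0<..t} v * (lam v * rate \<omega> v)"
      using AE_hazard_rate AE_lborel_singleton[of 0]
      by eventually_elim (auto simp: sos_intensity_def rate_def split: split_indicator)
    have nn: "AE v in lborel. 0 \<le> ?I v"
      using eq by eventually_elim (auto simp: lam_nonneg rate_nonneg)
    have "Lam t \<omega> = (\<integral>v. ?I v \<partial>lborel)" by (simp add: Lam_def set_lebesgue_integral_def)
    moreover have "0 \<le> (\<integral>v. ?I v \<partial>lborel)" using nn by (rule integral_nonneg_AE)
    moreover have "ennreal (\<integral>v. ?I v \<partial>lborel) = (\<integral>\<^sup>+v. ennreal (?I v) \<partial>lborel)"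
      by (rule nn_integral_eq_integral[OF int nn, symmetric])
    moreover have "\<dots> = dcomp \<omega> 0 t"
      unfolding dcomp_def using eq
      by (intro nn_integral_cong_AE, eventually_elim)
        (simp add: lam_nonneg rate_nonneg ennreal_mult ennreal_indicator)
    ultimately show "0 \<le> Lam t \<omega> \<and> ennreal (Lam t \<omega>) = dcomp \<omega> 0 t" by simp
  qed
qed

lemma dcomp_split:
  assumes "0 \<le> s" "s \<le> t" "\<omega> \<in> space P"
  shows "dcomp \<omega> 0 t = dcomp \<omega> 0 s + dcomp \<omega> s t"
proof -
  note [measurable] = rate_meas'[OF assms(3)]
  show ?thesis unfolding dcomp_def using assms
    by (subst nn_integral_add[symmetric]) (auto intro!: nn_integral_cong split: split_indicator)
qed

lemma AE_dcomp:
  assumes "0 \<le> s" "s \<le> t"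
  shows "AE \<omega> in P. 0 \<le> Lam t \<omega> - Lam s \<omega> \<and> ennreal (Lam t \<omega> - Lam s \<omega>) = dcomp \<omega> s t"
  using AE_comp AE_space
proof eventually_elim
  case (elim \<omega>)
  have "ennreal (Lam t \<omega>) = ennreal (Lam s \<omega>) + dcomp \<omega> s t"
    using dcomp_split[OF assms elim(2)] elim(1) assms by simp
  moreover have "0 \<le> Lam t \<omega>" "0 \<le> Lam s \<omega>" using elim(1) assms by auto
  ultimately show ?case
    by (cases "dcomp \<omega> s t") (auto simp: ennreal_plus[symmetric] simp del: ennreal_plus)
qed

lemma Lam_integrable:
  assumes "0 \<le> t" shows "integrable P (Lam t)"
proof -
  have "integrable P (\<lambda>\<omega>. cnt t \<omega> - Lam t \<omega>)"
    using mart assms by (simp add: martingale_def)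
  from Bochner_Integration.integrable_diff[OF cnt_integrable[of t] this] show ?thesis by simp
qed

text \<open>The martingale property integrated over an event of the past. Both increments are
  nonnegative almost surely, so the identity passes to extended nonnegative integrals.\<close>

lemma increments:
  assumes st: "0 \<le> s" "s \<le> t" and A: "A \<in> sets (Fl s)"
  shows "(\<integral>\<^sup>+\<omega>. indicator A \<omega> * ennreal (cnt t \<omega> - cnt s \<omega>) \<partial>P) = (\<integral>\<^sup>+\<omega>. indicator A \<omega> * dcomp \<omega> s t \<partial>P)"
proof -
  have AP [measurable]: "A \<in> sets P" using A Fl_subset by blast
  interpret S: finite_measure_subalgebra P "Fl s"
    by unfold_locales (rule subalg)
  let ?Z = "\<lambda>t \<omega>. cnt t \<omega> - Lam t \<omega>"
  have Zi: "integrable P (?Z t)" "integrable P (?Z s)"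
    using st by (auto intro!: cnt_integrable Lam_integrable Bochner_Integration.integrable_diff)
  have ii: "integrable P (\<lambda>\<omega>. indicator A \<omega> * f \<omega>)" if "integrable P f" for f :: "'a \<Rightarrow> real"
    using integrable_mult_indicator[OF AP that] by simp
  have "(\<integral>\<omega>. indicator A \<omega> * ?Z t \<omega> \<partial>P) = (\<integral>\<omega>. indicator A \<omega> * real_cond_exp P (Fl s) (?Z t) \<omega> \<partial>P)"
    using S.real_cond_exp_intA[OF Zi(1) A] by (simp add: set_lebesgue_integral_def)
  also have "\<dots> = (\<integral>\<omega>. indicator A \<omega> * ?Z s \<omega> \<partial>P)"
  proof (rule integral_cong_AE)
    show "AE \<omega> in P. indicator A \<omega> * real_cond_exp P (Fl s) (?Z t) \<omega> = indicator A \<omega> * ?Z s \<omega>"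
    proof -
      have "AE \<omega> in P. real_cond_exp P (Fl s) (?Z t) \<omega> = ?Z s \<omega>"
        using mart st by (simp add: martingale_def)
      then show ?thesis by eventually_elim simp
    qed
  qed (use Zi in \<open>auto intro!: borel_measurable_times\<close>)
  finally have Z: "(\<integral>\<omega>. indicator A \<omega> * ?Z t \<omega> \<partial>P) = (\<integral>\<omega>. indicator A \<omega> * ?Z s \<omega> \<partial>P)" .
  have "(\<integral>\<omega>. indicator A \<omega> * (cnt t \<omega> - cnt s \<omega>) \<partial>P) - (\<integral>\<omega>. indicator A \<omega> * (Lam t \<omega> - Lam s \<omega>) \<partial>P)
      = (\<integral>\<omega>. indicator A \<omega> * ?Z t \<omega> - indicator A \<omega> * ?Z s \<omega> \<partial>P)"
    using st by (subst Bochner_Integration.integral_diff[symmetric])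
      (auto intro!: ii cnt_integrable Lam_integrable Bochner_Integration.integrable_diff Bochner_Integration.integral_cong simp: algebra_simps)
  also have "\<dots> = 0" using Z ii[OF Zi(1)] ii[OF Zi(2)] by simp
  finally have eq: "(\<integral>\<omega>. indicator A \<omega> * (cnt t \<omega> - cnt s \<omega>) \<partial>P) = (\<integral>\<omega>. indicator A \<omega> * (Lam t \<omega> - Lam s \<omega>) \<partial>P)" by simp
  have "(\<integral>\<^sup>+\<omega>. indicator A \<omega> * ennreal (cnt t \<omega> - cnt s \<omega>) \<partial>P) = (\<integral>\<^sup>+\<omega>. ennreal (indicator A \<omega> * (cnt t \<omega> - cnt s \<omega>)) \<partial>P)"
    by (intro nn_integral_cong) (auto split: split_indicator)
  also have "\<dots> = ennreal (\<integral>\<omega>. indicator A \<omega> * (cnt t \<omega> - cnt s \<omega>) \<partial>P)"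
    using cnt_mono[OF st(2)] by (intro nn_integral_eq_integral ii) (auto intro!: cnt_integrable)
  also have "\<dots> = (\<integral>\<^sup>+\<omega>. ennreal (indicator A \<omega> * (Lam t \<omega> - Lam s \<omega>)) \<partial>P)"
    unfolding eq using AE_dcomp[OF st] st
    by (intro nn_integral_eq_integral[symmetric] ii Bochner_Integration.integrable_diff Lam_integrable)
      (auto elim!: AE_mp)
  also have "\<dots> = (\<integral>\<^sup>+\<omega>. indicator A \<omega> * dcomp \<omega> s t \<partial>P)"
    using AE_dcomp[OF st] by (intro nn_integral_cong_AE) (auto elim!: AE_mp split: split_indicator)
  finally show ?thesis .
qed

text \<open>The measures \<open>C \<mapsto> E \<integral> 1\<^sub>C dN\<close> and \<open>C \<mapsto> E \<integral> 1\<^sub>C d\<Lambda>\<close>.\<close>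

definition jumps :: "('a \<times> real) measure" where
  "jumps = distr (count_space {1..r} \<Otimes>\<^sub>M P) (P \<Otimes>\<^sub>M borel) (\<lambda>(j, \<omega>). (\<omega>, X j \<omega>))"

definition comps :: "('a \<times> real) measure" where
  "comps = density (P \<Otimes>\<^sub>M lborel) (\<lambda>(\<omega>, v). ennreal (lam v) * ennreal (rate \<omega> v))"

lemma sets_jumps [simp]: "sets jumps = sets (P \<Otimes>\<^sub>M borel)"
  and sets_comps [simp]: "sets comps = sets (P \<Otimes>\<^sub>M borel)"
  by (auto simp: jumps_def comps_def intro!: sets_pair_measure_cong)

lemma emeasure_jumps:
  assumes C [measurable]: "C \<in> sets (P \<Otimes>\<^sub>M borel)"
  shows "emeasure jumps C = (\<Sum>j\<in>{1..r}. \<integral>\<^sup>+\<omega>. indicator C (\<omega>, X j \<omega>) \<partial>P)"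
proof -
  have [measurable]: "(\<lambda>(j, \<omega>). (\<omega>, X j \<omega>)) \<in> measurable (count_space {1..r} \<Otimes>\<^sub>M P) (P \<Otimes>\<^sub>M borel)"
    by (rule measurable_pair_measure_countable1) auto
  have "emeasure jumps C = (\<integral>\<^sup>+z. indicator C z \<partial>jumps)" using C by simp
  also have "\<dots> = (\<integral>\<^sup>+z. indicator C ((\<lambda>(j, \<omega>). (\<omega>, X j \<omega>)) z) \<partial>(count_space {1..r} \<Otimes>\<^sub>M P))"
    unfolding jumps_def by (rule nn_integral_distr) measurable
  also have "\<dots> = (\<integral>\<^sup>+j. \<integral>\<^sup>+\<omega>. indicator C (\<omega>, X j \<omega>) \<partial>P \<partial>count_space {1..r})"
  proof -
    have "(\<lambda>z. indicator C ((\<lambda>(j, \<omega>). (\<omega>, X j \<omega>)) z) :: ennreal) \<in> borel_measurable (count_space {1..r} \<Otimes>\<^sub>M P)"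
      by measurable
    from P.nn_integral_fst[OF this] show ?thesis by simp
  qed
  also have "\<dots> = (\<Sum>j\<in>{1..r}. \<integral>\<^sup>+\<omega>. indicator C (\<omega>, X j \<omega>) \<partial>P)"
    by (simp add: nn_integral_count_space_finite)
  finally show ?thesis .
qed

lemma emeasure_comps:
  assumes C [measurable]: "C \<in> sets (P \<Otimes>\<^sub>M borel)"
  shows "emeasure comps C = (\<integral>\<^sup>+\<omega>. \<integral>\<^sup>+v. indicator C (\<omega>, v) * (ennreal (lam v) * ennreal (rate \<omega> v)) \<partial>lborel \<partial>P)"
proof -
  have [measurable_cong]: "sets (P \<Otimes>\<^sub>M lborel) = sets (P \<Otimes>\<^sub>M borel)" by (intro sets_pair_measure_cong) auto
  have "emeasure comps C = (\<integral>\<^sup>+z. (\<lambda>(\<omega>, v). ennreal (lam v) * ennreal (rate \<omega> v)) z * indicator C z \<partial>(P \<Otimes>\<^sub>M lborel))"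
    unfolding comps_def by (rule emeasure_density) measurable
  also have "\<dots> = (\<integral>\<^sup>+\<omega>. \<integral>\<^sup>+v. indicator C (\<omega>, v) * (ennreal (lam v) * ennreal (rate \<omega> v)) \<partial>lborel \<partial>P)"
    by (subst lborel.nn_integral_fst[symmetric]) (auto simp: mult.commute)
  finally show ?thesis .
qed

lemma jumps_comps_Ioc:
  assumes st: "0 \<le> s" "s \<le> t" and A: "A \<in> sets (Fl s)"
  shows "emeasure jumps (A \<times> {s<..t}) = emeasure comps (A \<times> {s<..t})"
proof -
  have AP [measurable]: "A \<in> sets P" using A Fl_subset by blast
  have C: "A \<times> {s<..t} \<in> sets (P \<Otimes>\<^sub>M borel)" by measurable
  have "emeasure jumps (A \<times> {s<..t}) = (\<integral>\<^sup>+\<omega>. (\<Sum>j\<in>{1..r}. indicator (A \<times> {s<..t}) (\<omega>, X j \<omega>)) \<partial>P)"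
    by (subst emeasure_jumps[OF C], subst nn_integral_sum) (auto intro!: borel_measurable_indicator')
  also have "\<dots> = (\<integral>\<^sup>+\<omega>. indicator A \<omega> * ennreal (cnt t \<omega> - cnt s \<omega>) \<partial>P)"
  proof (rule nn_integral_cong)
    fix \<omega>
    have "(\<Sum>j\<in>{1..r}. indicator (A \<times> {s<..t}) (\<omega>, X j \<omega>)) = ennreal (\<Sum>j\<in>{1..r}. indicator (A \<times> {s<..t}) (\<omega>, X j \<omega>))"
      by (subst sum_ennreal[symmetric]) (auto simp: ennreal_indicator)
    also have "(\<Sum>j\<in>{1..r}. indicator (A \<times> {s<..t}) (\<omega>, X j \<omega>)) = indicator A \<omega> * (cnt t \<omega> - cnt s \<omega>)"
      using st unfolding cnt_def failures_def of_nat_sum sum_subtractf[symmetric] sum_distrib_left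
      by (intro sum.cong) (auto split: split_indicator)
    finally show "(\<Sum>j\<in>{1..r}. indicator (A \<times> {s<..t}) (\<omega>, X j \<omega>)) = indicator A \<omega> * ennreal (cnt t \<omega> - cnt s \<omega>)"
      by (simp split: split_indicator)
  qed
  also have "\<dots> = (\<integral>\<^sup>+\<omega>. indicator A \<omega> * dcomp \<omega> s t \<partial>P)" by (rule increments[OF assms])
  also have "\<dots> = emeasure comps (A \<times> {s<..t})"
    unfolding emeasure_comps[OF C] dcomp_def
    by (intro nn_integral_cong) (auto split: split_indicator intro!: nn_integral_cong)
  finally show ?thesis .
qed

lemma jumps_comps_Ioi:
  assumes s: "0 \<le> s" and A: "A \<in> sets (Fl s)"
  shows "emeasure jumps (A \<times> {s<..}) = emeasure comps (A \<times> {s<..})"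
proof -
  have AP [measurable]: "A \<in> sets P" using A Fl_subset by blast
  have *: "(\<Union>n. A \<times> {s<..s + real n}) = A \<times> {s<..}"
  proof (intro equalityI subsetI)
    fix z assume z: "z \<in> A \<times> {s<..}"
    obtain n where "snd z - s < real n" using reals_Archimedean2 by blast
    with z show "z \<in> (\<Union>n. A \<times> {s<..s + real n})" by (auto intro!: exI[of _ n])
  qed auto
  have inc: "incseq (\<lambda>n. A \<times> {s<..s + real n})" by (auto simp: incseq_def)
  have "emeasure jumps (A \<times> {s<..}) = (SUP n. emeasure jumps (A \<times> {s<..s + real n}))"
    using inc unfolding *[symmetric] by (intro SUP_emeasure_incseq[symmetric]) auto
  also have "\<dots> = (SUP n. emeasure comps (A \<times> {s<..s + real n}))"
    using s A by (intro SUP_cong jumps_comps_Ioc) auto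
  also have "\<dots> = emeasure comps (A \<times> {s<..})"
    using inc unfolding *[symmetric] by (intro SUP_emeasure_incseq) auto
  finally show ?thesis .
qed

text \<open>Rectangles with unbounded time intervals are closed under intersection, and their
  differences supply the usual ones with bounded time intervals because the filtration increases.
  Time 0 is left out, as failure times are almost surely positive.\<close>

definition predictable :: "('a \<times> real) measure" where
  "predictable = sigma (space P \<times> {0<..}) {A \<times> {s<..} | A s. 0 \<le> s \<and> A \<in> sets (Fl s)}"

lemma predictable_gen: "{A \<times> {s<..} | A s. 0 \<le> s \<and> A \<in> sets (Fl s)} \<subseteq> Pow (space P \<times> {0<..})"
  using sets.sets_into_space[of _ "Fl _"] by (fastforce simp: space_Fl)

lemma space_predictable: "space predictable = space P \<times> {0<..}"
  and sets_predictable: "sets predictable = sigma_sets (space P \<times> {0<..}) {A \<times> {s<..} | A s. 0 \<le> s \<and> A \<in> sets (Fl s)}"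
  unfolding predictable_def using predictable_gen by (intro space_measure_of sets_measure_of; blast)+

lemma predictable_basic: "0 \<le> s \<Longrightarrow> A \<in> sets (Fl s) \<Longrightarrow> A \<times> {s<..} \<in> sets predictable"
  unfolding sets_predictable by (rule sigma_sets.Basic) blast

text \<open>Every path contributes at most \<open>r\<close> jumps. Finiteness permits the
  subtraction in the complement step of \<open>jumps_eq_comps\<close>.\<close>

lemma jumps_fin: "emeasure jumps C \<noteq> \<infinity>"
proof -
  have "emeasure jumps C \<le> emeasure jumps (space P \<times> UNIV)"
  proof (cases "C \<in> sets jumps")
    case True
    then show ?thesis using sets.sets_into_space[of C jumps] by (intro emeasure_mono) (auto simp: sets_eq_imp_space_eq[OF sets_jumps] space_pair_measure)
  qed (simp add: emeasure_notin_sets)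
  also have "\<dots> = (\<Sum>j\<in>{1..r}. \<integral>\<^sup>+\<omega>. indicator (space P \<times> UNIV) (\<omega>, X j \<omega>) \<partial>P)"
    by (intro emeasure_jumps) auto
  also have "\<dots> \<le> (\<Sum>j\<in>{1..r}. \<integral>\<^sup>+\<omega>. 1 \<partial>P)"
    by (intro sum_mono nn_integral_mono) (auto split: split_indicator)
  also have "\<dots> < \<infinity>" by (simp add: P.emeasure_space_1 ennreal_of_nat_eq_real_of_nat)
  finally show ?thesis by auto
qed

text \<open>Dynkin argument from the generating rectangles. Membership in the product sigma-algebra
  travels with the induction, because the complement and union steps use additivity of both measures
  there.\<close>

theorem jumps_eq_comps:
  assumes "C \<in> sets predictable"
  shows "C \<in> sets (P \<Otimes>\<^sub>M borel) \<and> emeasure jumps C = emeasure comps C"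
proof -
  let ?G = "{A \<times> {s<..} | A s. 0 \<le> s \<and> A \<in> sets (Fl s)}"
  have Int: "Int_stable ?G"
  proof (rule Int_stableI)
    fix a b assume "a \<in> ?G" "b \<in> ?G"
    then obtain A s B t where ab: "a = A \<times> {s<..}" "0 \<le> s" "A \<in> sets (Fl s)" "b = B \<times> {t<..}" "0 \<le> t" "B \<in> sets (Fl t)"
      by auto
    then have "A \<inter> B \<in> sets (Fl (max s t))"
      using Fl_mono[of s "max s t"] Fl_mono[of t "max s t"] by auto
    moreover have "a \<inter> b = (A \<inter> B) \<times> {max s t<..}" using ab by auto
    ultimately show "a \<inter> b \<in> ?G" using ab by (auto intro!: exI[of _ "A \<inter> B"] exI[of _ "max s t"])
  qed
  have \<Omega>: "space P \<times> {0::real<..} \<in> sets (P \<Otimes>\<^sub>M borel)" by (intro pair_measureI) auto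
  have \<Omega>eq: "emeasure jumps (space P \<times> {0<..}) = emeasure comps (space P \<times> {0<..})"
    using sets.top[of "Fl 0"] by (intro jumps_comps_Ioi) (auto simp: space_Fl)
  from Int predictable_gen assms[unfolded sets_predictable] show ?thesis
  proof (induction C rule: sigma_sets_induct_disjoint)
    case (basic A)
    then obtain B s where "A = B \<times> {s<..}" "0 \<le> s" "B \<in> sets (Fl s)" by auto
    then show ?case using jumps_comps_Ioi[of s B] Fl_subset[of s] by auto
  next
    case (compl A)
    have sub: "A \<subseteq> space P \<times> {0<..}"
      using compl(1) predictable_gen sigma_sets_into_sp by blast
    have "emeasure jumps (space P \<times> {0<..} - A) = emeasure jumps (space P \<times> {0<..}) - emeasure jumps A"
      using compl sub \<Omega> jumps_fin by (intro emeasure_Diff) auto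
    moreover have "emeasure comps (space P \<times> {0<..} - A) = emeasure comps (space P \<times> {0<..}) - emeasure comps A"
      using compl sub \<Omega> jumps_fin[of A] by (intro emeasure_Diff) auto
    ultimately show ?case using compl \<Omega> \<Omega>eq by auto
  next
    case (union A)
    have "emeasure jumps (\<Union>i. A i) = (\<Sum>i. emeasure jumps (A i))" "emeasure comps (\<Union>i. A i) = (\<Sum>i. emeasure comps (A i))"
      by (rule suminf_emeasure[symmetric]; use union in auto)+
    then show ?case using union by auto
  qed auto
qed

lemma snd_predictable [measurable]: "snd \<in> borel_measurable predictable"
  unfolding borel_measurable_iff_greater
proof
  fix a :: real
  have "{z \<in> space predictable. a < snd z} = space P \<times> {max 0 a<..}"
    by (auto simp: space_predictable)
  also have "\<dots> \<in> sets predictable"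
    using sets.top[of "Fl (max 0 a)"] by (intro predictable_basic) (auto simp: space_Fl)
  finally show "{z \<in> space predictable. a < snd z} \<in> sets predictable" .
qed

text \<open>A predictable version of \<open>min (X i \<omega>) s\<close>. The detour through the counts is needed because the
  filtration is generated by the counting process, which determines the failure times only when
  they are ordered.\<close>

definition seen :: "nat \<Rightarrow> 'a \<times> real \<Rightarrow> real" where
  "seen i z = (if i = 0 then 0 else
     INF q\<in>{q\<in>\<rat>. 0 \<le> q}. if q < snd z \<and> real i \<le> cnt q (fst z) then q else snd z)"

lemma seen_predictable [measurable]: "seen i \<in> borel_measurable predictable"
proof (cases "i = 0")
  case False
  have "(\<lambda>z. if q < snd z \<and> real i \<le> cnt q (fst z) then q else snd z) \<in> borel_measurable predictable"
    if q: "0 \<le> q" for q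
  proof -
    have "{z \<in> space predictable. q < snd z \<and> real i \<le> cnt q (fst z)} = (cnt q -` {real i..} \<inter> space P) \<times> {q<..}"
      using q by (auto simp: space_predictable)
    also have "\<dots> \<in> sets predictable"
      using q by (intro predictable_basic cnt_Fl) auto
    finally show ?thesis by (intro measurable_If[OF _ _ ]) (rule snd_predictable | assumption | simp)+
  qed
  note m = this
  have c: "countable {q::real. q \<in> \<rat> \<and> 0 \<le> q}"
    by (rule countable_subset[OF _ countable_rat]) auto
  have "(\<lambda>z. INF q\<in>{q\<in>\<rat>. 0 \<le> q}. if q < snd z \<and> real i \<le> cnt q (fst z) then q else snd z) \<in> borel_measurable predictable"
    by (rule borel_measurable_cINF_real[OF c], rule m, simp)
  with False show ?thesis by (simp add: seen_def[abs_def])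
qed (simp add: seen_def[abs_def])

section \<open>Failure times on the cumulative hazard scale\<close>

definition X0 :: "nat \<Rightarrow> 'a \<Rightarrow> real" where
  "X0 i \<omega> = (if i = 0 then 0 else X i \<omega>)"

definition gap :: "nat \<Rightarrow> 'a \<Rightarrow> real" where
  "gap i \<omega> = cumhaz (X0 i \<omega>) - cumhaz (X0 (i - 1) \<omega>)"

lemma X0_meas [measurable]: "i \<in> {0..r} \<Longrightarrow> X0 i \<in> borel_measurable P"
  by (cases "i = 0") (auto simp: X0_def[abs_def])

lemma gap_meas [measurable]: "i \<in> {1..r} \<Longrightarrow> gap i \<in> borel_measurable P"
proof -
  assume "i \<in> {1..r}"
  then have [measurable]: "X0 i \<in> borel_measurable P" "X0 (i - 1) \<in> borel_measurable P" by auto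
  show ?thesis unfolding gap_def[abs_def] by measurable
qed

text \<open>The last condition keeps \<open>cumhaz\<close> away from its default value at every
  failure.\<close>

definition good :: "'a \<Rightarrow> bool" where
  "good \<omega> \<longleftrightarrow> \<omega> \<in> space P \<and> (\<forall>j\<in>{1..r}. 0 < X j \<omega>) \<and>
     (\<forall>j\<in>{1..r}. \<forall>k\<in>{1..r}. j < k \<longrightarrow> X j \<omega> < X k \<omega>) \<and> (\<forall>j\<in>{1..r}. Fn (X j \<omega>) < 1)"

lemma AE_ordered: "AE \<omega> in P. (\<forall>j\<in>{1..r}. 0 < X j \<omega>) \<and> (\<forall>j\<in>{1..r}. \<forall>k\<in>{1..r}. j < k \<longrightarrow> X j \<omega> < X k \<omega>)"
  using sos by (auto simp: sequential_order_statistics_def)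

lemma failures_ge_iff:
  assumes "\<forall>j\<in>{1..r}. \<forall>k\<in>{1..r}. j < k \<longrightarrow> x j < (x k :: real)" "i \<in> {1..r}"
  shows "i \<le> failures r x t \<longleftrightarrow> x i \<le> t" "i \<le> failures_before r x t \<longleftrightarrow> x i < t"
  unfolding failures_def failures_before_def
  by (rule sum_of_bool_ge_iff; use assms in force)+

text \<open>Up to a failure the rate is at least the smallest \<open>\<gamma> j\<close>. If the cdf
  were 1 at that failure, the compensator would dominate a positive multiple of an infinite hazard,
  but it is finite.\<close>

lemma AE_good: "AE \<omega> in P. good \<omega>"
  using AE_ordered AE_comp AE_space
proof eventually_elim
  case (elim \<omega>)
  have "Fn (X j \<omega>) < 1" if j: "j \<in> {1..r}" for j
  proof (rule ccontr)
    assume "\<not> Fn (X j \<omega>) < 1"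
    then have 1: "Fn (X j \<omega>) = 1" using Fn_le_1[of "X j \<omega>"] by simp
    define m where "m = Min (\<gamma> ` {1..r})"
    have m: "0 < m" using j gamma_pos unfolding m_def by (subst Min_gr_iff) auto
    have rate: "m \<le> rate \<omega> v" if "v \<le> X j \<omega>" for v
    proof -
      have "\<not> j \<le> failures_before r (\<lambda>j. X j \<omega>) v"
        using failures_ge_iff(2)[of "\<lambda>j. X j \<omega>" j v] elim j that by auto
      then have "failures_before r (\<lambda>j. X j \<omega>) v + 1 \<in> {1..r}" using j by auto
      then show ?thesis unfolding rate_def zero_ext_def m_def by auto
    qed
    note [measurable] = rate_meas'[OF elim(3)]
    have "\<infinity> = ennreal m * (\<integral>\<^sup>+v. ennreal (lam v) * indicator {0<..X j \<omega>} v \<partial>lborel)"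
      using m nn_integral_lam_infinite[OF 1] by (simp add: ennreal_mult_top)
    also have "\<dots> = (\<integral>\<^sup>+v. ennreal m * (ennreal (lam v) * indicator {0<..X j \<omega>} v) \<partial>lborel)"
      by (rule nn_integral_cmult[symmetric]) simp
    also have "\<dots> \<le> dcomp \<omega> 0 (X j \<omega>)"
      unfolding dcomp_def
    proof (rule nn_integral_mono)
      fix v
      have "ennreal (lam v) * ennreal m \<le> ennreal (lam v) * ennreal (rate \<omega> v)" if "v \<le> X j \<omega>"
        using rate[OF that] by (intro mult_left_mono ennreal_leI) auto
      then show "ennreal m * (ennreal (lam v) * indicator {0<..X j \<omega>} v)
          \<le> indicator {0<..X j \<omega>} v * (ennreal (lam v) * ennreal (rate \<omega> v))"
        by (simp add: mult.commute split: split_indicator)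
    qed
    also have "\<dots> = ennreal (Lam (X j \<omega>) \<omega>)" using elim j by (auto simp: less_imp_le)
    finally show False by (simp add: top_unique)
  qed
  with elim show ?case unfolding good_def by blast
qed

context
  fixes \<omega> assumes g: "good \<omega>"
begin

lemma good_pos: "j \<in> {1..r} \<Longrightarrow> 0 < X j \<omega>"
  and good_less: "j \<in> {1..r} \<Longrightarrow> k \<in> {1..r} \<Longrightarrow> j < k \<Longrightarrow> X j \<omega> < X k \<omega>"
  and good_Fn: "j \<in> {1..r} \<Longrightarrow> Fn (X j \<omega>) < 1"
  and good_space: "\<omega> \<in> space P"
  using g by (auto simp: good_def)

lemma X0_less: "j \<in> {1..r} \<Longrightarrow> X0 (j - 1) \<omega> < X0 j \<omega>"
proof (cases "j = 1")
  case False
  assume "j \<in> {1..r}"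
  with False have "j - 1 \<in> {1..r}" "j \<in> {1..r}" "j - 1 < j" by auto
  from good_less[OF this] show ?thesis using False \<open>j \<in> {1..r}\<close> by (auto simp: X0_def)
qed (use good_pos[of j] in \<open>simp add: X0_def\<close>)

lemma X0_mono: "i \<le> j \<Longrightarrow> j \<le> r \<Longrightarrow> X0 i \<omega> \<le> X0 j \<omega>"
  using good_pos[of j] good_less[of i j] by (cases "i = j") (auto simp: X0_def)

lemma X0_nonneg: "j \<le> r \<Longrightarrow> 0 \<le> X0 j \<omega>"
  using good_pos[of j] by (auto simp: X0_def)

lemma Fn_X0: "j \<le> r \<Longrightarrow> Fn (X0 j \<omega>) < 1"
  using good_Fn[of j] by (auto simp: X0_def Fn_0)

lemma gap_nonneg: "j \<in> {1..r} \<Longrightarrow> 0 \<le> gap j \<omega>"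
  using X0_less[of j] Fn_X0[of j] cumhaz_mono[of "X0 (j - 1) \<omega>" "X0 j \<omega>"] by (auto simp: gap_def)

text \<open>On ordered paths the count at \<open>q\<close> is at least \<open>i\<close> iff
  \<open>X i \<omega> \<le> q\<close>. If \<open>X i \<omega> < s\<close>, rationals between the two
  bring the infimum down to \<open>X i \<omega>\<close>; otherwise every term equals
  \<open>s\<close>.\<close>

lemma seen_eq:
  assumes "i \<le> r" "0 < s"
  shows "seen i (\<omega>, s) = min (X0 i \<omega>) s"
proof (cases "i = 0")
  case False
  then have i: "i \<in> {1..r}" using assms by auto
  have cnt: "real i \<le> cnt q \<omega> \<longleftrightarrow> X i \<omega> \<le> q" for q
    using failures_ge_iff(1)[of "\<lambda>j. X j \<omega>" i q] good_less i by (simp add: cnt_def)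
  let ?f = "\<lambda>q. if q < s \<and> X i \<omega> \<le> q then q else s"
  let ?A = "{q\<in>\<rat>. 0 \<le> (q::real)}"
  have A0: "0 \<in> ?A" by simp
  have lb: "min (X i \<omega>) s \<le> ?f q" for q by auto
  have bdd: "bdd_below (?f ` ?A)" using lb by (intro bdd_belowI[of _ "min (X i \<omega>) s"]) auto
  have "(INF q\<in>?A. ?f q) = min (X i \<omega>) s"
  proof (rule antisym)
    show "min (X i \<omega>) s \<le> (INF q\<in>?A. ?f q)" using A0 lb by (intro cINF_greatest) auto
    show "(INF q\<in>?A. ?f q) \<le> min (X i \<omega>) s"
    proof (cases "X i \<omega> < s")
      case True
      show ?thesis
      proof (rule dense_ge)
        fix c assume "min (X i \<omega>) s < c"
        then have "X i \<omega> < min c s" using True by auto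
        then obtain q where q: "q \<in> \<rat>" "X i \<omega> < q" "q < min c s" using Rats_dense_in_real by blast
        then have "(INF q\<in>?A. ?f q) \<le> ?f q" using good_pos[OF i] by (intro cINF_lower[OF bdd]) auto
        then show "(INF q\<in>?A. ?f q) \<le> c" using q by simp
      qed
    next
      case False
      have "(INF q\<in>?A. ?f q) \<le> ?f 0" by (rule cINF_lower[OF bdd A0])
      then show ?thesis using False assms good_pos[OF i] by simp
    qed
  qed
  then show ?thesis using False by (simp add: seen_def cnt X0_def)
qed (use assms in \<open>simp add: seen_def X0_def\<close>)

text \<open>The interval is closed on the right because \<open>failures_before\<close> counts
  strictly earlier failures: at the j-th failure time itself the rate is still the j-th one.\<close>

lemma rate_eq:
  assumes j: "j \<in> {1..r}" and v: "X0 (j - 1) \<omega> < v" "v \<le> X0 j \<omega>"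
  shows "rate \<omega> v = \<gamma> j"
proof -
  have ord: "\<forall>j\<in>{1..r}. \<forall>k\<in>{1..r}. j < k \<longrightarrow> X j \<omega> < X k \<omega>" using good_less by blast
  have "\<not> j \<le> failures_before r (\<lambda>j. X j \<omega>) v"
    using failures_ge_iff(2)[OF ord j] v j by (auto simp: X0_def)
  moreover have "j - 1 \<le> failures_before r (\<lambda>j. X j \<omega>) v"
  proof (cases "j = 1")
    case False
    with j have "j - 1 \<in> {1..r}" by auto
    from failures_ge_iff(2)[OF ord this] show ?thesis using v False j by (auto simp: X0_def)
  qed simp
  ultimately have "failures_before r (\<lambda>j. X j \<omega>) v + 1 = j" using j by auto
  then show ?thesis using j by (simp add: rate_def zero_ext_def)
qed

lemma Fn_X_eq:
  assumes j: "j \<in> {1..r}"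
  shows "Fn (X j \<omega>) = 1 - exp (- (\<Sum>i=1..j. gap i \<omega>))"
proof -
  have "(\<Sum>i=1..k. gap i \<omega>) = cumhaz (X0 k \<omega>)" for k
    by (induction k) (auto simp: gap_def X0_def cumhaz_0)
  then show ?thesis using j good_Fn[OF j] Fn_eq_exp[of "X j \<omega>"] by (simp add: X0_def)
qed

end

text \<open>Times in the j-th stage, after the hazard has grown by more than \<open>c\<close> within
  it, on the event that each earlier spacing \<open>i\<close> exceeds \<open>u i\<close>. Using
  \<open>seen\<close> for the failure times makes the set predictable.\<close>

definition window :: "nat \<Rightarrow> (nat \<Rightarrow> real) \<Rightarrow> real \<Rightarrow> ('a \<times> real) set" where
  "window j u c = {z \<in> space predictable. seen (j - 1) z < snd z \<and> snd z \<le> seen j z \<and>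
     (\<forall>i\<in>{1..<j}. u i < cumhaz (seen i z) - cumhaz (seen (i - 1) z)) \<and>
     c < cumhaz (snd z) - cumhaz (seen (j - 1) z)}"

definition past :: "nat \<Rightarrow> (nat \<Rightarrow> real) \<Rightarrow> 'a set" where
  "past j u = {\<omega> \<in> space P. \<forall>i\<in>{1..<j}. u i < gap i \<omega>}"

lemma window_predictable: "window j u c \<in> sets predictable"
  unfolding window_def by measurable

lemma past_meas [measurable]: "j \<le> Suc r \<Longrightarrow> past j u \<in> sets P"
proof -
  assume j: "j \<le> Suc r"
  have "past j u = {\<omega> \<in> space P. \<forall>i\<in>{1..<j} \<inter> {1..r}. u i < gap i \<omega>}" using j by (auto simp: past_def)
  also have "\<dots> \<in> sets P" by measurable
  finally show ?thesis .
qed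

text \<open>In the j-th stage \<open>s\<close> lies beyond \<open>X0 (j - 1) \<omega>\<close>, so
  the censoring at \<open>s\<close> in \<open>seen\<close> does not touch the earlier failure times,
  and \<open>seen j\<close> enters only through the comparison with \<open>s\<close>. For
  \<open>s \<le> 0\<close> both sides fail, as \<open>X0\<close> is nonnegative.\<close>

lemma window_iff:
  assumes g: "good \<omega>" and j: "j \<in> {1..r}"
  shows "(\<omega>, s) \<in> window j u c \<longleftrightarrow>
    X0 (j - 1) \<omega> < s \<and> s \<le> X0 j \<omega> \<and> \<omega> \<in> past j u \<and> c < cumhaz s - cumhaz (X0 (j - 1) \<omega>)"
proof (cases "0 < s")
  case True
  note seen = seen_eq[OF g _ True]
  have "X0 i \<omega> < s" if "i < j" "X0 (j - 1) \<omega> < s" for i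
  proof -
    have "X0 i \<omega> \<le> X0 (j - 1) \<omega>" using that j by (intro X0_mono[OF g]) auto
    then show ?thesis using that by simp
  qed
  then have eq: "seen i (\<omega>, s) = X0 i \<omega>" if "i < j" "X0 (j - 1) \<omega> < s" for i
    using seen[of i] that j by (simp add: less_imp_le)
  have "seen (j - 1) (\<omega>, s) < s \<longleftrightarrow> X0 (j - 1) \<omega> < s" "s \<le> seen j (\<omega>, s) \<longleftrightarrow> s \<le> X0 j \<omega>"
    using seen[of "j - 1"] seen[of j] j by auto
  then have "(\<omega>, s) \<in> window j u c \<longleftrightarrow> X0 (j - 1) \<omega> < s \<and> s \<le> X0 j \<omega> \<and>
      (\<forall>i\<in>{1..<j}. u i < cumhaz (seen i (\<omega>, s)) - cumhaz (seen (i - 1) (\<omega>, s))) \<and>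
      c < cumhaz s - cumhaz (seen (j - 1) (\<omega>, s))"
    using True good_space[OF g] by (simp add: window_def space_predictable)
  also have "\<dots> \<longleftrightarrow> X0 (j - 1) \<omega> < s \<and> s \<le> X0 j \<omega> \<and> \<omega> \<in> past j u \<and> c < cumhaz s - cumhaz (X0 (j - 1) \<omega>)"
  proof (cases "X0 (j - 1) \<omega> < s")
    case True
    have "seen (j - 1) (\<omega>, s) = X0 (j - 1) \<omega>" using j by (intro eq True) auto
    moreover have "seen i (\<omega>, s) = X0 i \<omega> \<and> seen (i - 1) (\<omega>, s) = X0 (i - 1) \<omega>" if "i \<in> {1..<j}" for i
      using that by (intro conjI eq True) auto
    ultimately show ?thesis using good_space[OF g] by (simp add: past_def gap_def)
  qed simp
  finally show ?thesis .
next
  case False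
  moreover have "0 \<le> X0 (j - 1) \<omega>" using j by (intro X0_nonneg[OF g]) auto
  ultimately show ?thesis by (auto simp: window_def space_predictable)
qed

text \<open>Earlier failures precede the j-th stage and later ones follow it, so only the j-th jump
  can fall into the window; at that jump the growth of hazard since the stage began is
  \<open>gap j \<omega>\<close>.\<close>

lemma jumps_window:
  assumes j: "j \<in> {1..r}"
  shows "emeasure jumps (window j u c) = emeasure P {\<omega> \<in> past j u. c < gap j \<omega>}"
proof -
  have C: "window j u c \<in> sets (P \<Otimes>\<^sub>M borel)" using jumps_eq_comps[OF window_predictable] by blast
  have [measurable]: "past j u \<in> sets P" using j by simp
  have "{\<omega> \<in> past j u. c < gap j \<omega>} = past j u \<inter> {\<omega> \<in> space P. c < gap j \<omega>}" by (auto simp: past_def)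
  then have [measurable]: "{\<omega> \<in> past j u. c < gap j \<omega>} \<in> sets P" using j by simp
  have "(\<integral>\<^sup>+\<omega>. indicator (window j u c) (\<omega>, X k \<omega>) \<partial>P)
    = (if k = j then emeasure P {\<omega> \<in> past j u. c < gap j \<omega>} else 0)" if k: "k \<in> {1..r}" for k
  proof -
    have "(\<integral>\<^sup>+\<omega>. indicator (window j u c) (\<omega>, X k \<omega>) \<partial>P)
      = (\<integral>\<^sup>+\<omega>. (if k = j then indicator {\<omega> \<in> past j u. c < gap j \<omega>} \<omega> else 0) \<partial>P)"
    proof (rule nn_integral_cong_AE, use AE_good in eventually_elim)
      case (elim \<omega>)
      have Xk: "X k \<omega> = X0 k \<omega>" using k by (simp add: X0_def)
      consider "k = j" | "k < j" | "j < k" by linarith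
      then show ?case
      proof cases
        case 1
        have "X0 j \<omega> = X j \<omega>" using j by (simp add: X0_def)
        then show ?thesis using window_iff[OF elim j, of "X j \<omega>" u c] X0_less[OF elim j] 1
          by (auto simp: gap_def split: split_indicator)
      next
        case 2
        then have "X0 k \<omega> \<le> X0 (j - 1) \<omega>" using j by (intro X0_mono[OF elim]) auto
        then show ?thesis using window_iff[OF elim j, of "X k \<omega>" u c] 2
          by (auto simp: Xk split: split_indicator)
      next
        case 3
        then show ?thesis using window_iff[OF elim j, of "X k \<omega>" u c] good_less[OF elim, of j k] j k 3
          by (auto simp: X0_def split: split_indicator)
      qed
    qed
    then show ?thesis by simp
  qed
  then show ?thesis using j by (simp add: emeasure_jumps[OF C])
qed

text \<open>Inside the window the rate is the constant \<open>\<gamma> j\<close>, and what remains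
  is the hazard in excess of \<open>c\<close> over one stage.\<close>

lemma comps_window:
  assumes j: "j \<in> {1..r}"
  shows "emeasure comps (window j u c) =
    ennreal (\<gamma> j) * (\<integral>\<^sup>+\<omega>. indicator (past j u) \<omega> * ennreal (gap j \<omega> - max 0 c) \<partial>P)"
proof -
  have C: "window j u c \<in> sets (P \<Otimes>\<^sub>M borel)" using jumps_eq_comps[OF window_predictable] by blast
  have [measurable]: "past j u \<in> sets P" "gap j \<in> borel_measurable P" using j by simp_all
  have "emeasure comps (window j u c) = (\<integral>\<^sup>+\<omega>. ennreal (\<gamma> j) * (indicator (past j u) \<omega> * ennreal (gap j \<omega> - max 0 c)) \<partial>P)"
    unfolding emeasure_comps[OF C]
  proof (rule nn_integral_cong_AE, use AE_good in eventually_elim)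
    case (elim \<omega>)
    let ?S = "{v. X0 (j - 1) \<omega> < v \<and> v \<le> X0 j \<omega> \<and> c < cumhaz v - cumhaz (X0 (j - 1) \<omega>)}"
    have "(\<integral>\<^sup>+v. indicator (window j u c) (\<omega>, v) * (ennreal (lam v) * ennreal (rate \<omega> v)) \<partial>lborel)
      = (\<integral>\<^sup>+v. ennreal (\<gamma> j) * indicator (past j u) \<omega> * (ennreal (lam v) * indicator ?S v) \<partial>lborel)"
      using window_iff[OF elim j] rate_eq[OF elim j]
      by (intro nn_integral_cong) (auto simp: mult_ac split: split_indicator)
    also have "\<dots> = ennreal (\<gamma> j) * indicator (past j u) \<omega> * (\<integral>\<^sup>+v. ennreal (lam v) * indicator ?S v \<partial>lborel)"
      by (rule nn_integral_cmult) measurable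
    also have "(\<integral>\<^sup>+v. ennreal (lam v) * indicator ?S v \<partial>lborel) = ennreal (gap j \<omega> - max 0 c)"
      unfolding gap_def using X0_less[OF elim j] Fn_X0[OF elim, of j] j
      by (intro nn_integral_lam_excess') auto
    finally show ?case by (simp add: mult.assoc)
  qed
  also have "\<dots> = ennreal (\<gamma> j) * (\<integral>\<^sup>+\<omega>. indicator (past j u) \<omega> * ennreal (gap j \<omega> - max 0 c) \<partial>P)"
    by (rule nn_integral_cmult) measurable
  finally show ?thesis .
qed

text \<open>Given that the earlier spacings exceed their thresholds, the window identity is the
  equation of \<open>exponential_survival\<close> for the next spacing. The product form means
  independent exponential spacings with rates \<open>\<gamma> i\<close>.\<close>

lemma gap_survival:
  assumes "j \<le> r" "\<And>i. 0 \<le> u i"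
  shows "P.prob {\<omega> \<in> space P. \<forall>i\<in>{1..j}. u i < gap i \<omega>} = (\<Prod>i=1..j. exp (- (\<gamma> i * u i)))"
  using assms(1)
proof (induction j)
  case 0
  then show ?case by (simp add: P.prob_space)
next
  case (Suc j)
  then have j: "Suc j \<in> {1..r}" by simp
  have "AE \<omega> in P. 0 \<le> gap (Suc j) \<omega>" using AE_good by eventually_elim (rule gap_nonneg[OF _ j])
  moreover have "emeasure P {\<omega> \<in> past (Suc j) u. c < gap (Suc j) \<omega>} = ennreal (\<gamma> (Suc j)) *
      (\<integral>\<^sup>+\<omega>. indicator (past (Suc j) u) \<omega> * ennreal (gap (Suc j) \<omega> - max 0 c) \<partial>P)" for c
    using jumps_window[OF j, of u c] comps_window[OF j, of u c] jumps_eq_comps[OF window_predictable, of "Suc j" u c] by simp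
  ultimately have "P.prob {\<omega> \<in> past (Suc j) u. u (Suc j) < gap (Suc j) \<omega>} = exp (- (\<gamma> (Suc j) * u (Suc j))) * P.prob (past (Suc j) u)"
    using j gamma_pos[OF j] assms(2)[of "Suc j"] by (intro P.exponential_survival) auto
  moreover have "{\<omega> \<in> past (Suc j) u. u (Suc j) < gap (Suc j) \<omega>} = {\<omega> \<in> space P. \<forall>i\<in>{1..Suc j}. u i < gap i \<omega>}"
    by (auto simp: past_def atLeastLessThanSuc_atLeastAtMost atLeastAtMostSuc_conv)
  moreover have "past (Suc j) u = {\<omega> \<in> space P. \<forall>i\<in>{1..j}. u i < gap i \<omega>}"
    by (simp add: past_def atLeastLessThanSuc_atLeastAtMost)
  ultimately show ?case using Suc by (simp add: mult.commute)
qed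

text \<open>Extends the formula to all real thresholds, which
  \<open>joint_survival_determines_law\<close> quantifies over; spacings are almost surely positive,
  so negative thresholds act like 0.\<close>

lemma gap_survival':
  "P.prob {\<omega> \<in> space P. \<forall>i\<in>{1..r}. u i < gap i \<omega>} = (\<Prod>i=1..r. exp (- (\<gamma> i * max 0 (u i))))"
proof -
  have "P.prob {\<omega> \<in> space P. \<forall>i\<in>{1..r}. 0 < gap i \<omega>} = 1" using gap_survival[of r "\<lambda>_. 0"] by simp
  then have "AE \<omega> in P. \<omega> \<in> {\<omega> \<in> space P. \<forall>i\<in>{1..r}. 0 < gap i \<omega>}" by (rule P.AE_prob_1)
  then have "AE \<omega> in P. \<omega> \<in> {\<omega> \<in> space P. \<forall>i\<in>{1..r}. u i < gap i \<omega>} \<longleftrightarrow> \<omega> \<in> {\<omega> \<in> space P. \<forall>i\<in>{1..r}. max 0 (u i) < gap i \<omega>}"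
    by eventually_elim auto
  then have "P.prob {\<omega> \<in> space P. \<forall>i\<in>{1..r}. u i < gap i \<omega>} = P.prob {\<omega> \<in> space P. \<forall>i\<in>{1..r}. max 0 (u i) < gap i \<omega>}"
    by (intro P.finite_measure_eq_AE) measurable
  then show ?thesis using gap_survival[of r "\<lambda>i. max 0 (u i)"] by simp
qed

text \<open>The set of times at which the cdf equals \<open>c\<close> is deterministic, hence
  predictable, and carries no hazard. So it has mass 0 for the compensator and therefore for the
  jumps.\<close>

lemma AE_not_level: "AE \<omega> in P. \<forall>j\<in>{1..r}. Fn (X j \<omega>) \<noteq> c"
proof -
  let ?C = "{z \<in> space predictable. Fn (snd z) = c}"
  have C: "?C \<in> sets predictable" by measurable
  then have CP [measurable]: "?C \<in> sets (P \<Otimes>\<^sub>M borel)" using jumps_eq_comps by blast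
  have "emeasure comps ?C = (\<integral>\<^sup>+\<omega>. 0 \<partial>P)"
    unfolding emeasure_comps[OF CP]
  proof (rule nn_integral_cong)
    fix \<omega>
    have "(\<integral>\<^sup>+v. indicator ?C (\<omega>, v) * (ennreal (lam v) * ennreal (rate \<omega> v)) \<partial>lborel) = (\<integral>\<^sup>+v. 0 \<partial>(lborel :: real measure))"
    proof (rule nn_integral_cong_AE)
      show "AE v in lborel. indicator ?C (\<omega>, v) * (ennreal (lam v) * ennreal (rate \<omega> v)) = 0"
        using AE_lam_level[of c] by eventually_elim (auto split: split_indicator)
    qed
    then show "(\<integral>\<^sup>+v. indicator ?C (\<omega>, v) * (ennreal (lam v) * ennreal (rate \<omega> v)) \<partial>lborel) = 0" by simp
  qed
  then have "emeasure jumps ?C = 0" using jumps_eq_comps[OF C] by simp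
  then have *: "(\<integral>\<^sup>+\<omega>. indicator ?C (\<omega>, X j \<omega>) \<partial>P) = 0" if "j \<in> {1..r}" for j
    using that by (simp add: emeasure_jumps[OF CP])
  have "AE \<omega> in P. (indicator ?C (\<omega>, X j \<omega>) :: ennreal) = 0" if "j \<in> {1..r}" for j
  proof -
    have [measurable]: "X j \<in> borel_measurable P" using that by simp
    show ?thesis using * [OF that] by (subst (asm) nn_integral_0_iff_AE) (measurable, use that in simp_all)
  qed
  then have "AE \<omega> in P. \<forall>j\<in>{1..r}. (indicator ?C (\<omega>, X j \<omega>) :: ennreal) = 0"
    by (simp add: AE_finite_all)
  with AE_good show ?thesis
  proof eventually_elim
    case (elim \<omega>)
    then show ?case using good_pos[OF elim(1)] good_space[OF elim(1)]
      by (auto simp: space_predictable indicator_def split: if_splits)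
  qed
qed

end

section \<open>The transformed sample\<close>

lemma sos_processI:
  assumes "F \<in> ac_cdfs" "prob_space P" "\<forall>j\<in>{1..r}. 0 < \<gamma> j" "sequential_order_statistics P r \<gamma> F X"
  obtains D M where "sos_process D M P r \<gamma> X" "F = cdf M"
proof -
  obtain D M where DM: "ac_baseline D M" "F = cdf M" using ac_cdfs_baseline[OF assms(1)] .
  then have "sos_process D M P r \<gamma> X"
    using assms unfolding sos_process_def sos_process_axioms_def by auto
  with DM that show ?thesis by blast
qed

section \<open>Quantiles and preservation of order under a continuous cdf\<close>

context
  fixes F :: "real \<Rightarrow> real"
  assumes F: "F \<in> ac_cdfs"
begin

lemma ac_cdf_mono: "x \<le> y \<Longrightarrow> F x \<le> F y"
  and ac_cdf_cont: "isCont F x"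
  and ac_cdf_surj: "0 \<le> p \<Longrightarrow> p < 1 \<Longrightarrow> \<exists>t. F t = p"
proof -
  obtain D M where "ac_baseline D M" and eq: "F = cdf M" using ac_cdfs_baseline[OF F] .
  then interpret ac_baseline D M by simp
  show "x \<le> y \<Longrightarrow> F x \<le> F y" "isCont F x" "0 \<le> p \<Longrightarrow> p < 1 \<Longrightarrow> \<exists>t. F t = p"
    unfolding eq using Fn_mono isCont_Fn Fn_surj by blast+
qed

lemma ac_cdf_borel [measurable]: "F \<in> borel_measurable borel"
  by (intro borel_measurable_mono monoI ac_cdf_mono)

text \<open>For the strict inequality, continuity gives some \<open>s\<close> to the right of
  \<open>t\<close> with \<open>F s < u\<close>; monotonicity then puts the whole infimum at or above
  \<open>s\<close>.\<close>

lemma less_quantile_iff: "ereal t < quantile F u \<longleftrightarrow> F t < u"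
proof
  assume t: "ereal t < quantile F u"
  show "F t < u"
  proof (rule ccontr)
    assume "\<not> F t < u"
    then have "quantile F u \<le> ereal t" unfolding quantile_def by (intro INF_lower) auto
    with t show False by simp
  qed
next
  assume "F t < u"
  then have "eventually (\<lambda>s. F s < u) (at_right t)"
    using ac_cdf_cont[of t] by (intro order_tendstoD(2)) (auto simp: isCont_def filterlim_at_split)
  then obtain b where b: "t < b" "\<And>s. t < s \<Longrightarrow> s < b \<Longrightarrow> F s < u"
    by (auto simp: eventually_at_right_field)
  define s where "s = (t + b) / 2"
  have s: "t < s" "F s < u" using b unfolding s_def by auto
  have "ereal s \<le> quantile F u"
    unfolding quantile_def
  proof (rule INF_greatest)
    fix x assume "x \<in> {x. u \<le> F x}"
    then have "\<not> x \<le> s" using ac_cdf_mono[of x s] s by auto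
    then show "ereal s \<le> ereal x" by simp
  qed
  moreover have "ereal t < ereal s" using s by simp
  ultimately show "ereal t < quantile F u" by (rule less_le_trans[rotated])
qed

text \<open>The infimum is the left endpoint of the support. Quantiles of small levels stay above
  it, and fall below any larger bound once the level is below \<open>F x\<close> for a suitable
  \<open>x\<close>.\<close>

lemma quantile_0_plus_eq: "quantile_0_plus F = (INF x\<in>{x. 0 < F x}. ereal x)" (is "_ = ?L")
proof -
  have "(quantile F \<longlongrightarrow> ?L) (at_right 0)"
  proof (rule order_tendstoI)
    fix a assume a: "a < ?L"
    have "?L \<le> quantile F u" if "0 < u" for u
      unfolding quantile_def using that by (intro INF_superset_mono) auto
    then show "eventually (\<lambda>u. a < quantile F u) (at_right 0)"
      using eventually_at_right_less[of "0::real"] by (auto elim!: eventually_mono intro: less_le_trans[OF a])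
  next
    fix a assume "?L < a"
    then obtain x where x: "0 < F x" "ereal x < a" by (auto simp: INF_less_iff)
    have "quantile F u < a" if "u < F x" for u
    proof -
      have "quantile F u \<le> ereal x" unfolding quantile_def using that by (intro INF_lower) auto
      with x show ?thesis by simp
    qed
    then show "eventually (\<lambda>u. quantile F u < a) (at_right 0)"
      using x by (auto simp: eventually_at_right_field)
  qed
  then show ?thesis unfolding quantile_0_plus_def by (intro tendsto_Lim) auto
qed

lemma quantile_0_plus_less_iff: "quantile_0_plus F < ereal t \<longleftrightarrow> 0 < F t"
proof
  assume "quantile_0_plus F < ereal t"
  then obtain x where "0 < F x" "x < t" by (auto simp: quantile_0_plus_eq INF_less_iff)
  then show "0 < F t" using ac_cdf_mono[of x t] by simp
next
  assume "0 < F t"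
  then have "eventually (\<lambda>s. 0 < F s) (at_left t)"
    using ac_cdf_cont[of t] by (intro order_tendstoD(1)) (auto simp: isCont_def filterlim_at_split)
  then obtain b where b: "b < t" "\<And>s. b < s \<Longrightarrow> s < t \<Longrightarrow> 0 < F s"
    by (auto simp: eventually_at_left_field)
  then show "quantile_0_plus F < ereal t"
    unfolding quantile_0_plus_eq INF_less_iff by (intro bexI[of _ "(b + t) / 2"]) auto
qed

lemma quantile_interval:
  "{t. quantile_0_plus F < ereal t \<and> ereal t < quantile F q} = {t. 0 < F t \<and> F t < q}"
  by (simp add: less_quantile_iff quantile_0_plus_less_iff)

lemma ac_cdf_image:
  assumes "q \<le> 1"
  shows "F ` {t. 0 < F t \<and> F t < q} = {0<..<q}"
proof (intro equalityI subsetI)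
  fix p assume p: "p \<in> {0<..<q}"
  then obtain t where "F t = p" using ac_cdf_surj[of p] assms by auto
  then show "p \<in> F ` {t. 0 < F t \<and> F t < q}" using p by (intro image_eqI[of _ _ t]) auto
qed auto

text \<open>Every nondegenerate interval on which \<open>F\<close> is constant contains a rational point.\<close>

lemma ac_cdf_less_iff:
  assumes "F y \<notin> F ` \<rat>"
  shows "x < y \<longleftrightarrow> F x < F y" "y \<le> x \<longleftrightarrow> F y \<le> F x"
proof -
  show "x < y \<longleftrightarrow> F x < F y"
  proof
    assume "x < y"
    then obtain s where s: "s \<in> \<rat>" "x < s" "s < y" using Rats_dense_in_real by blast
    then have "F x \<le> F s" "F s \<le> F y" using ac_cdf_mono by (auto simp: less_imp_le)
    moreover have "F s \<noteq> F y" using assms s(1) by (metis imageI)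
    ultimately
    show "F x < F y" by linarith
  next
    assume "F x < F y"
    then show "x < y" using ac_cdf_mono[of y x] by (cases "x < y") auto
  qed
  then show "y \<le> x \<longleftrightarrow> F y \<le> F x" by (auto simp: not_less[symmetric])
qed

text \<open>The image of the rationals under \<open>F\<close> is countable, so the null sets
  belonging to single levels combine. This supplies the hypothesis of \<open>ac_cdf_less_iff\<close>
  at all data points.\<close>

lemma AE_sos_not_rational_level:
  assumes "prob_space P" "\<forall>j\<in>{1..r}. 0 < \<gamma> j" "sequential_order_statistics P r \<gamma> F X"
  shows "AE \<omega> in P. \<forall>j\<in>{1..r}. F (X j \<omega>) \<notin> F ` \<rat>"
proof -
  obtain D M where "sos_process D M P r \<gamma> X" and eq: "F = cdf M" using sos_processI[OF F assms] .
  then interpret sos_process D M P r \<gamma> X by simp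
  have "AE \<omega> in P. \<forall>c\<in>F ` \<rat>. \<forall>j\<in>{1..r}. F (X j \<omega>) \<noteq> c"
    using AE_not_level by (subst AE_ball_countable) (auto simp: eq countable_rat)
  then show ?thesis by eventually_elim auto
qed

end

lemma sos_transformed_law:
  fixes X :: "nat \<Rightarrow> 'a \<Rightarrow> real" and Y :: "nat \<Rightarrow> 'b \<Rightarrow> real"
  assumes gamma: "\<forall>j\<in>{1..r}. 0 < \<gamma> j"
    and F: "F \<in> ac_cdfs" "prob_space P" "sequential_order_statistics P r \<gamma> F X"
    and G: "G \<in> ac_cdfs" "prob_space Q" "sequential_order_statistics Q r \<gamma> G Y"
  defines "S \<equiv> PiM {1..r} (\<lambda>_. borel :: real measure)"
  shows "distr P S (\<lambda>\<omega>. \<lambda>j\<in>{1..r}. F (X j \<omega>)) = distr Q S (\<lambda>\<omega>. \<lambda>j\<in>{1..r}. G (Y j \<omega>))"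
proof -
  obtain D M where "sos_process D M P r \<gamma> X" and eqF: "F = cdf M" using sos_processI[OF F(1,2) gamma F(3)] .
  then interpret F: sos_process D M P r \<gamma> X by simp
  obtain D' M' where "sos_process D' M' Q r \<gamma> Y" and eqG: "G = cdf M'" using sos_processI[OF G(1,2) gamma G(3)] .
  then interpret G: sos_process D' M' Q r \<gamma> Y by simp
  \<comment> \<open>Recovers the transformed failure times from the spacings of the cumulative
    hazard by a formula that does not mention the baseline.\<close>
  define \<Phi> :: "(nat \<Rightarrow> real) \<Rightarrow> nat \<Rightarrow> real" where "\<Phi> d = (\<lambda>j\<in>{1..r}. 1 - exp (- (\<Sum>i=1..j. d i)))" for d
  have \<Phi> [measurable]: "\<Phi> \<in> measurable S S"
    unfolding \<Phi>_def S_def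
  proof (rule measurable_restrict)
    fix j assume "j \<in> {1..r}"
    then have "(\<lambda>d. d i) \<in> borel_measurable (PiM {1..r} (\<lambda>_. borel))" if "i \<in> {1..j}" for i
      using that by (intro measurable_component_singleton) auto
    then have m: "(\<lambda>d. \<Sum>i=1..j. d i) \<in> borel_measurable (PiM {1..r} (\<lambda>_. borel :: real measure))"
      by (rule borel_measurable_sum)
    show "(\<lambda>d. 1 - exp (- (\<Sum>i=1..j. d i))) \<in> borel_measurable (PiM {1..r} (\<lambda>_. borel :: real measure))"
      by (intro borel_measurable_diff borel_measurable_const
        measurable_compose[OF borel_measurable_uminus[OF m] borel_measurable_exp])
  qed
  have gF: "(\<lambda>\<omega>. restrict (\<lambda>i. F.gap i \<omega>) {1..r}) \<in> measurable P S"
    unfolding S_def by (intro measurable_restrict F.gap_meas)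
  have gG: "(\<lambda>\<omega>. restrict (\<lambda>i. G.gap i \<omega>) {1..r}) \<in> measurable Q S"
    unfolding S_def by (intro measurable_restrict G.gap_meas)
  have "distr P S (\<lambda>\<omega>. \<lambda>j\<in>{1..r}. F (X j \<omega>)) = distr P S (\<lambda>\<omega>. \<Phi> (restrict (\<lambda>i. F.gap i \<omega>) {1..r}))"
  proof (rule distr_cong_AE)
    show "AE \<omega> in P. (\<lambda>j\<in>{1..r}. F (X j \<omega>)) = \<Phi> (restrict (\<lambda>i. F.gap i \<omega>) {1..r})"
      using F.AE_good by eventually_elim (auto simp: \<Phi>_def eqF F.Fn_X_eq fun_eq_iff restrict_def)
    show "(\<lambda>\<omega>. \<lambda>j\<in>{1..r}. F (X j \<omega>)) \<in> measurable P S"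
      unfolding S_def eqF by (intro measurable_restrict measurable_compose[OF F.X_meas F.Fn_borel])
  qed (use gF in measurable)
  also have "\<dots> = distr (distr P S (\<lambda>\<omega>. restrict (\<lambda>i. F.gap i \<omega>) {1..r})) S \<Phi>"
    using gF by (simp add: distr_distr o_def)
  also have "distr P S (\<lambda>\<omega>. restrict (\<lambda>i. F.gap i \<omega>) {1..r}) = distr Q S (\<lambda>\<omega>. restrict (\<lambda>i. G.gap i \<omega>) {1..r})"
    unfolding S_def using F.gap_survival' G.gap_survival'
    by (intro joint_survival_determines_law F.gap_meas G.gap_meas F G) auto
  also have "distr (distr Q S (\<lambda>\<omega>. restrict (\<lambda>i. G.gap i \<omega>) {1..r})) S \<Phi> = distr Q S (\<lambda>\<omega>. \<Phi> (restrict (\<lambda>i. G.gap i \<omega>) {1..r}))"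
    using gG by (simp add: distr_distr o_def)
  also have "\<dots> = distr Q S (\<lambda>\<omega>. \<lambda>j\<in>{1..r}. G (Y j \<omega>))"
  proof (rule distr_cong_AE)
    show "AE \<omega> in Q. \<Phi> (restrict (\<lambda>i. G.gap i \<omega>) {1..r}) = (\<lambda>j\<in>{1..r}. G (Y j \<omega>))"
      using G.AE_good by eventually_elim (auto simp: \<Phi>_def eqG G.Fn_X_eq fun_eq_iff restrict_def)
    show "(\<lambda>\<omega>. \<lambda>j\<in>{1..r}. G (Y j \<omega>)) \<in> measurable Q S"
      unfolding S_def eqG by (intro measurable_restrict measurable_compose[OF G.X_meas G.Fn_borel])
  qed (use gG in measurable)
  finally show ?thesis .
qed

lemma iid_sample_product_law:
  fixes Z :: "nat \<Rightarrow> nat \<Rightarrow> 'a \<Rightarrow> real"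
  assumes M: "1 \<le> M" and H: "H \<in> ac_cdfs" and Z: "iid_sos_sample R r M \<gamma> H Z"
  defines "S \<equiv> PiM {1..r} (\<lambda>_. borel :: real measure)"
  shows "distr R (PiM {1..M} (\<lambda>_. S)) (\<lambda>\<omega>. \<lambda>i\<in>{1..M}. \<lambda>j\<in>{1..r}. H (Z i j \<omega>)) =
      PiM {1..M} (\<lambda>i. distr R S (\<lambda>\<omega>. \<lambda>j\<in>{1..r}. H (Z i j \<omega>)))"
proof -
  interpret R: prob_space R using Z by (simp add: iid_sos_sample_def)
  have ind: "R.indep_vars (\<lambda>_. S) (\<lambda>i \<omega>. \<lambda>j\<in>{1..r}. Z i j \<omega>) {1..M}"
    using Z by (simp add: iid_sos_sample_def Let_def S_def)
  have g: "(\<lambda>x. \<lambda>j\<in>{1..r}. H (x j)) \<in> measurable S S"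
    unfolding S_def by (intro measurable_restrict measurable_compose[OF _ ac_cdf_borel[OF H]] measurable_component_singleton)
  have "R.indep_vars (\<lambda>_. S) (\<lambda>i \<omega>. (\<lambda>x. \<lambda>j\<in>{1..r}. H (x j)) (\<lambda>j\<in>{1..r}. Z i j \<omega>)) {1..M}"
    by (rule R.indep_vars_compose2[OF ind g])
  also have "(\<lambda>i \<omega>. (\<lambda>x. \<lambda>j\<in>{1..r}. H (x j)) (\<lambda>j\<in>{1..r}. Z i j \<omega>)) = (\<lambda>i \<omega>. \<lambda>j\<in>{1..r}. H (Z i j \<omega>))"
    by (auto simp: fun_eq_iff restrict_def)
  finally have ind': "R.indep_vars (\<lambda>_. S) (\<lambda>i \<omega>. \<lambda>j\<in>{1..r}. H (Z i j \<omega>)) {1..M}" .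
  then have rv: "(\<lambda>\<omega>. \<lambda>j\<in>{1..r}. H (Z i j \<omega>)) \<in> measurable R S" if "i \<in> {1..M}" for i
    using that by (auto simp: R.indep_vars_def)
  have ne: "{1..M} \<noteq> {}" using M by simp
  show ?thesis
    using R.indep_vars_iff_distr_eq_PiM'[OF ne, where M'="\<lambda>_. S" and X="\<lambda>i \<omega>. \<lambda>j\<in>{1..r}. H (Z i j \<omega>)"] rv ind' by blast
qed

lemma iid_sample_transformed_law:
  fixes X :: "nat \<Rightarrow> nat \<Rightarrow> 'a \<Rightarrow> real" and Y :: "nat \<Rightarrow> nat \<Rightarrow> 'b \<Rightarrow> real"
  assumes gamma: "\<forall>j\<in>{1..r}. 0 < \<gamma> j" and M: "1 \<le> M"
    and F: "F \<in> ac_cdfs" "iid_sos_sample P r M \<gamma> F X"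
    and G: "G \<in> ac_cdfs" "iid_sos_sample Q r M \<gamma> G Y"
  defines "S \<equiv> PiM {1..r} (\<lambda>_. borel :: real measure)"
  shows "distr P (PiM {1..M} (\<lambda>_. S)) (\<lambda>\<omega>. \<lambda>i\<in>{1..M}. \<lambda>j\<in>{1..r}. F (X i j \<omega>)) =
    distr Q (PiM {1..M} (\<lambda>_. S)) (\<lambda>\<omega>. \<lambda>i\<in>{1..M}. \<lambda>j\<in>{1..r}. G (Y i j \<omega>))"
proof -
  have "prob_space P" "prob_space Q" using F G by (auto simp: iid_sos_sample_def)
  moreover have "sequential_order_statistics P r \<gamma> F (X i)" "sequential_order_statistics Q r \<gamma> G (Y i)"
    if "i \<in> {1..M}" for i using F G that by (auto simp: iid_sos_sample_def)
  ultimately show ?thesis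
    unfolding S_def iid_sample_product_law[OF M F] iid_sample_product_law[OF M G]
    by (intro PiM_cong refl sos_transformed_law[OF gamma]) (use F G in auto)
qed

section \<open>The estimators and the statistic\<close>

lemma zero_ext_cong: "(\<And>j. j \<in> {1..r} \<Longrightarrow> g j = h j) \<Longrightarrow> zero_ext r g = zero_ext r h"
  by (auto simp: zero_ext_def)

lemma total_rate_cong:
  assumes "\<And>k l. k \<in> {1..M} \<Longrightarrow> l \<in> {1..r} \<Longrightarrow> x k l < s \<longleftrightarrow> y k l < t"
    and "\<And>j. j \<in> {1..r} \<Longrightarrow> g j = h j"
  shows "total_rate r M g x s = total_rate r M h y t"
proof -
  have "failures_before r (x k) s = failures_before r (y k) t" if "k \<in> {1..M}" for k
    unfolding failures_before_def using assms(1) that by (intro sum.cong) auto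
  moreover have "zero_ext r g = zero_ext r h" using assms(2) by (rule zero_ext_cong)
  ultimately show ?thesis
    unfolding total_rate_def by (intro sum.cong) auto
qed

text \<open>The jump heights of the estimator and the profile likelihood evaluate the total rate
  only at data points, so these comparisons determine them for given weights.\<close>

definition same_order :: "nat \<Rightarrow> nat \<Rightarrow> (nat \<Rightarrow> nat \<Rightarrow> real) \<Rightarrow> (nat \<Rightarrow> nat \<Rightarrow> real) \<Rightarrow> bool" where
  "same_order r M x y \<longleftrightarrow>
     (\<forall>k\<in>{1..M}. \<forall>l\<in>{1..r}. \<forall>i\<in>{1..M}. \<forall>j\<in>{1..r}. x k l < x i j \<longleftrightarrow> y k l < y i j)"

lemma total_rate_same_order:
  assumes "same_order r M x y" "i \<in> {1..M}" "j \<in> {1..r}" "\<And>j. j \<in> {1..r} \<Longrightarrow> g j = h j"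
  shows "total_rate r M g x (x i j) = total_rate r M h y (y i j)"
  using assms by (intro total_rate_cong) (auto simp: same_order_def)

text \<open>Moves the dependence on the data from the index set into the factors, as needed for
  measurability and for comparing two samples.\<close>

lemma nelson_aalen_prod:
  "nelson_aalen r M g x t =
     1 - (\<Prod>i=1..M. \<Prod>j=1..r. if x i j \<le> t then 1 - inverse (total_rate r M g x (x i j)) else 1)"
proof -
  have "(\<Prod>(i, j)\<in>{(i, j). i \<in> {1..M} \<and> j \<in> {1..r} \<and> x i j \<le> t}. 1 - inverse (total_rate r M g x (x i j)))
    = (\<Prod>(i, j)\<in>{1..M} \<times> {1..r}. if x i j \<le> t then 1 - inverse (total_rate r M g x (x i j)) else 1)"
    by (rule prod.mono_neutral_cong_left) (auto split: if_splits)
  then show ?thesis by (simp add: nelson_aalen_def prod.cartesian_product)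
qed

lemma nelson_aalen_same_order:
  assumes "same_order r M x y" "\<And>j. j \<in> {1..r} \<Longrightarrow> g j = h j"
    and "\<And>i j. i \<in> {1..M} \<Longrightarrow> j \<in> {1..r} \<Longrightarrow> x i j \<le> s \<longleftrightarrow> y i j \<le> t"
  shows "nelson_aalen r M g x s = nelson_aalen r M h y t"
  unfolding nelson_aalen_prod
  by (intro arg_cong[where f="\<lambda>p. 1 - p"] prod.cong refl)
    (use assms(3) total_rate_same_order[OF assms(1) _ _ assms(2)] in auto)

lemma gamma_PL_same_order:
  assumes "same_order r M x y"
  shows "gamma_PL n r M x = gamma_PL n r M y"
proof -
  have "profile_likelihood r M x = profile_likelihood r M y"
    unfolding profile_likelihood_def using total_rate_same_order[OF assms]
    by (intro ext prod.cong) auto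
  then show ?thesis by (simp add: gamma_PL_def)
qed

lemma gamma_ML_transform:
  assumes "\<And>i l. i \<in> {1..M} \<Longrightarrow> l \<in> {1..r} \<Longrightarrow> y i l = H (x i l)" "j \<in> {1..r}"
  shows "gamma_ML n M H x j = gamma_ML n M (\<lambda>p. p) y j"
proof (cases "j = 1")
  case False
  \<comment> \<open>For \<open>j = 1\<close> the spacing would read the entry \<open>x i 0\<close>,
    which is not controlled; there \<open>gamma_ML\<close> is \<open>n\<close> by
    definition.\<close>
  with assms(2) have "j - 1 \<in> {1..r}" by auto
  with assms have "normalized_spacing n H x i j = normalized_spacing n (\<lambda>p. p) y i j" if "i \<in> {1..M}" for i
    using that by (simp add: normalized_spacing_def)
  then show ?thesis using False by (simp add: gamma_ML_def)
qed (simp add: gamma_ML_def)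

section \<open>Measurability of the estimators\<close>

context
  fixes r M :: nat and N :: "'a measure" and x :: "'a \<Rightarrow> nat \<Rightarrow> nat \<Rightarrow> real"
  assumes x [measurable]: "\<And>i j. i \<in> {1..M} \<Longrightarrow> j \<in> {1..r} \<Longrightarrow> (\<lambda>\<omega>. x \<omega> i j) \<in> borel_measurable N"
begin

text \<open>The value depends on the data only through the set \<open>pat\<close> of pairwise
  comparisons, of which there are finitely many. A representative sample for each pattern makes the
  estimator a function on a finite set, however \<open>arg_max_on\<close> chooses.\<close>

lemma gamma_PL_measurable: "(\<lambda>\<omega>. gamma_PL n r M (x \<omega>) j) \<in> borel_measurable N"
proof -
  define K where "K = {1..M} \<times> {1..r} \<times> {1..M} \<times> {1..r}"
  define pat where "pat = (\<lambda>y :: nat \<Rightarrow> nat \<Rightarrow> real. {(k, l, i, j) \<in> K. y k l < y i j})"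
  define c where "c R = gamma_PL n r M (SOME y. pat y = R)" for R
  have "finite K" by (simp add: K_def)
  have pat_eq: "same_order r M y z" if "pat y = pat z" for y z
  proof -
    have "y k l < y i j \<longleftrightarrow> z k l < z i j" if K: "(k, l, i, j) \<in> K" for k l i j
    proof -
      have "(k, l, i, j) \<in> pat y \<longleftrightarrow> (k, l, i, j) \<in> pat z" using \<open>pat y = pat z\<close> by simp
      then show ?thesis using K by (simp add: pat_def)
    qed
    then show ?thesis unfolding same_order_def K_def by auto
  qed
  have "pat (SOME y. pat y = pat (x \<omega>)) = pat (x \<omega>)" for \<omega> by (rule someI[of _ "x \<omega>"]) simp
  then have eq: "gamma_PL n r M (x \<omega>) = c (pat (x \<omega>))" for \<omega>
    unfolding c_def by (intro gamma_PL_same_order pat_eq) simp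
  have "(\<lambda>\<omega>. pat (x \<omega>)) \<in> measurable N (count_space (Pow K))"
  proof (subst measurable_count_space_eq2, simp add: \<open>finite K\<close>, intro conjI ballI)
    show "(\<lambda>\<omega>. pat (x \<omega>)) \<in> space N \<rightarrow> Pow K" by (auto simp: pat_def)
    fix R assume "R \<in> Pow K"
    moreover have "pat y \<subseteq> K" for y by (auto simp: pat_def)
    ultimately have "(\<lambda>\<omega>. pat (x \<omega>)) -` {R} \<inter> space N = {\<omega> \<in> space N. \<forall>z\<in>K. z \<in> pat (x \<omega>) \<longleftrightarrow> z \<in> R}"
      by blast
    also have "\<dots> \<in> sets N"
    proof (rule sets.sets_Collect_finite_All)
      fix z assume z: "z \<in> K"
      obtain k l i j where klij: "z = (k, l, i, j)" by (cases z)
      with z have "k \<in> {1..M}" "l \<in> {1..r}" "i \<in> {1..M}" "j \<in> {1..r}" by (auto simp: K_def)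
      note [measurable] = x[OF this(1,2)] x[OF this(3,4)]
      have "{\<omega> \<in> space N. x \<omega> k l < x \<omega> i j \<longleftrightarrow> z \<in> R} \<in> sets N" by measurable
      then show "{\<omega> \<in> space N. z \<in> pat (x \<omega>) \<longleftrightarrow> z \<in> R} \<in> sets N"
        using z by (simp add: pat_def klij)
    qed fact
    finally show "(\<lambda>\<omega>. pat (x \<omega>)) -` {R} \<inter> space N \<in> sets N" .
  qed
  from measurable_compose[OF this, of "\<lambda>R. c R j" borel] show ?thesis by (simp add: eq)
qed

lemma gamma_ML_measurable:
  assumes [measurable]: "H \<in> borel_measurable borel" and j: "j \<in> {1..r}"
  shows "(\<lambda>\<omega>. gamma_ML n M H (x \<omega>) j) \<in> borel_measurable N"
proof (cases "j = 1")
  case False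
  then have j': "j - 1 \<in> {1..r}" using j by auto
  have [measurable]: "(\<lambda>\<omega>. normalized_spacing n H (x \<omega>) i j) \<in> borel_measurable N" if "i \<in> {1..M}" for i
  proof -
    note [measurable] = x[OF that j] x[OF that j']
    show ?thesis unfolding normalized_spacing_def by measurable
  qed
  show ?thesis using False by (simp add: gamma_ML_def)
qed (simp add: gamma_ML_def)

lemma total_rate_measurable:
  assumes g: "\<And>j. j \<in> {1..r} \<Longrightarrow> (\<lambda>\<omega>. g \<omega> j) \<in> borel_measurable N"
    and [measurable]: "s \<in> borel_measurable N"
  shows "(\<lambda>\<omega>. total_rate r M (g \<omega>) (x \<omega>) (s \<omega>)) \<in> borel_measurable N"
  unfolding total_rate_def
proof (rule borel_measurable_sum)
  fix k assume k: "k \<in> {1..M}"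
  have m: "(\<lambda>\<omega>. failures_before r (x \<omega> k) (s \<omega>) + 1) \<in> measurable N (count_space UNIV)"
    using x[OF k] by measurable
  have "(\<lambda>\<omega>. zero_ext r (g \<omega>) m) \<in> borel_measurable N" for m
    unfolding zero_ext_def using g by (cases "m \<in> {1..r}") auto
  from measurable_compose_countable[OF this m]
  show "(\<lambda>\<omega>. zero_ext r (g \<omega>) (failures_before r (x \<omega> k) (s \<omega>) + 1)) \<in> borel_measurable N" .
qed

lemma nelson_aalen_measurable:
  assumes g: "\<And>j. j \<in> {1..r} \<Longrightarrow> (\<lambda>\<omega>. g \<omega> j) \<in> borel_measurable N"
  shows "(\<lambda>\<omega>. nelson_aalen r M (g \<omega>) (x \<omega>) t) \<in> borel_measurable N"
  unfolding nelson_aalen_prod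
proof (intro borel_measurable_diff borel_measurable_const borel_measurable_prod)
  fix i j assume ij: "i \<in> {1..M}" "j \<in> {1..r}"
  note [measurable] = x[OF ij] total_rate_measurable[OF g x[OF ij]]
  show "(\<lambda>\<omega>. if x \<omega> i j \<le> t then 1 - inverse (total_rate r M (g \<omega>) (x \<omega>) (x \<omega> i j)) else 1) \<in> borel_measurable N"
    by measurable
qed

end

text \<open>A step function with finitely many jumps, each already included at its own time.\<close>

lemma nelson_aalen_right_constant:
  "eventually (\<lambda>s. nelson_aalen r M g x s = nelson_aalen r M g x t) (at_right t)"
proof -
  have "eventually (\<lambda>s. x i j \<le> s \<longleftrightarrow> x i j \<le> t) (at_right t)" for i j
  proof (cases "x i j \<le> t")
    case True
    show ?thesis using eventually_at_right_less[of t] by eventually_elim (use True in auto)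
  next
    case False
    then have "eventually (\<lambda>s. s \<in> {t<..<x i j}) (at_right t)" by (intro eventually_at_right_real) auto
    then show ?thesis by eventually_elim (use False in auto)
  qed
  then have "eventually (\<lambda>s. \<forall>i\<in>{1..M}. \<forall>j\<in>{1..r}. x i j \<le> s \<longleftrightarrow> x i j \<le> t) (at_right t)"
    by (simp add: eventually_ball_finite)
  then show ?thesis
    by eventually_elim (auto simp: nelson_aalen_prod intro!: prod.cong)
qed

section \<open>The supremum as a measurable function of the data\<close>

context
  fixes T :: "real \<times> real \<Rightarrow> real" and E :: "real \<times> real \<Rightarrow> ereal"
  assumes T: "continuous_on ({0..1} \<times> {0<..<1}) T"
    and E: "continuous_on (({..<0} \<union> {1<..}) \<times> {0<..<1}) E"
begin

text \<open>With the first argument fixed only one branch of \<open>completed\<close> occurs, so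
  continuity holds across all \<open>p\<close> although \<open>T\<close> and \<open>E\<close> need
  not fit together at 0 and 1.\<close>

lemma completed_continuous: "continuous_on {0<..<1} (\<lambda>p. completed T E (v, p))"
proof (cases "v \<in> {0..1}")
  case True
  have "continuous_on {0<..<1} (\<lambda>p. ereal (T (v, p)))"
    using True by (intro continuous_on_ereal continuous_on_compose2[OF T] continuous_intros) auto
  then show ?thesis
    by (rule continuous_on_eq) (use True in \<open>auto simp: completed_def\<close>)
next
  case False
  have "continuous_on {0<..<1} (\<lambda>p. E (v, p))"
    using False by (intro continuous_on_compose2[OF E] continuous_intros) auto
  then show ?thesis
    by (rule continuous_on_eq) (use False in \<open>auto simp: completed_def\<close>)
qed

lemma completed_measurable:
  assumes p: "0 < p" "p < 1"
  shows "(\<lambda>v. completed T E (v, p)) \<in> borel_measurable borel"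
proof -
  have "(\<lambda>v. if v \<in> {0..1} then ereal (T (v, p)) else E (v, p)) \<in> borel_measurable borel"
  proof (subst measurable_If_restrict_space_iff, simp, intro conjI)
    have "continuous_on {0..1} (\<lambda>v. ereal (T (v, p)))"
      using p by (intro continuous_on_ereal continuous_on_compose2[OF T] continuous_intros) auto
    moreover have "{v::real. v \<in> {0..1}} = {0..1}" by auto
    ultimately show "(\<lambda>v. ereal (T (v, p))) \<in> borel_measurable (restrict_space borel {v. v \<in> {0..1}})"
      by (metis borel_measurable_continuous_on_restrict)
    have "{v::real. v \<notin> {0..1}} = {..<0} \<union> {1<..}" by auto
    moreover have "continuous_on ({..<0} \<union> {1<..}) (\<lambda>v. E (v, p))"
      using p by (intro continuous_on_compose2[OF E] continuous_intros) auto
    ultimately show "(\<lambda>v. E (v, p)) \<in> borel_measurable (restrict_space borel {v. v \<notin> {0..1}})"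
      by (intro borel_measurable_continuous_on_restrict) simp
  qed
  then show ?thesis using p by (simp add: completed_def)
qed

text \<open>The paths of the statistic are right-continuous, so the supremum may be taken over the rationals.\<close>

lemma SUP_completed_rational:
  assumes H: "\<And>t. isCont H t" and q: "q \<le> 1"
  shows "(SUP t\<in>{t. 0 < H t \<and> H t < q}. completed T E (nelson_aalen r M g x t, H t)) =
    (SUP t\<in>{t \<in> \<rat>. 0 < H t \<and> H t < q}. completed T E (nelson_aalen r M g x t, H t))"
    (is "_ = ?R")
proof (rule antisym)
  show "(SUP t\<in>{t. 0 < H t \<and> H t < q}. completed T E (nelson_aalen r M g x t, H t)) \<le> ?R"
  proof (rule SUP_least)
    fix t assume "t \<in> {t. 0 < H t \<and> H t < q}"
    then have t: "0 < H t" "H t < q" by auto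
    let ?v = "nelson_aalen r M g x t"
    have Ht: "(H \<longlongrightarrow> H t) (at_right t)" using H[of t] by (auto simp: isCont_def filterlim_at_split)
    have "isCont (\<lambda>p. completed T E (?v, p)) (H t)"
      using completed_continuous[of ?v] t q by (simp add: continuous_on_eq_continuous_at)
    then have lim: "((\<lambda>s. completed T E (?v, H s)) \<longlongrightarrow> completed T E (?v, H t)) (at_right t)"
      by (rule isCont_tendsto_compose[OF _ Ht])
    show "completed T E (?v, H t) \<le> ?R"
    proof (rule dense_le)
      fix a assume "a < completed T E (?v, H t)"
      then have "eventually (\<lambda>s. a < completed T E (?v, H s)) (at_right t)"
        by (rule order_tendstoD(1)[OF lim])
      moreover have "eventually (\<lambda>s. 0 < H s) (at_right t)" "eventually (\<lambda>s. H s < q) (at_right t)"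
        using order_tendstoD[OF Ht] t by auto
      ultimately have "eventually (\<lambda>s. a < completed T E (nelson_aalen r M g x s, H s) \<and> 0 < H s \<and> H s < q) (at_right t)"
        using nelson_aalen_right_constant[of r M g x t] by eventually_elim simp
      then obtain b where b: "t < b" "\<And>s. t < s \<Longrightarrow> s < b \<Longrightarrow> a < completed T E (nelson_aalen r M g x s, H s) \<and> 0 < H s \<and> H s < q"
        by (auto simp: eventually_at_right_field)
      obtain s where s: "s \<in> \<rat>" "t < s" "s < b" using Rats_dense_in_real[OF b(1)] by blast
      then have "completed T E (nelson_aalen r M g x s, H s) \<le> ?R" using b by (intro SUP_upper) auto
      moreover have "a < completed T E (nelson_aalen r M g x s, H s)" using b(2)[OF s(2,3)] by blast
      ultimately show "a \<le> ?R" by (meson less_imp_le less_le_trans)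
    qed
  qed
  show "?R \<le> (SUP t\<in>{t. 0 < H t \<and> H t < q}. completed T E (nelson_aalen r M g x t, H t))"
    by (rule SUP_subset_mono) auto
qed

lemma SUP_completed_measurable:
  assumes H: "\<And>t. isCont H t" and q: "q \<le> 1"
    and x: "\<And>i j. i \<in> {1..M} \<Longrightarrow> j \<in> {1..r} \<Longrightarrow> (\<lambda>\<omega>. x \<omega> i j) \<in> borel_measurable N"
    and g: "\<And>j. j \<in> {1..r} \<Longrightarrow> (\<lambda>\<omega>. g \<omega> j) \<in> borel_measurable N"
  shows "(\<lambda>\<omega>. SUP t\<in>{t. 0 < H t \<and> H t < q}. completed T E (nelson_aalen r M (g \<omega>) (x \<omega>) t, H t)) \<in> borel_measurable N"
  unfolding SUP_completed_rational[OF H q]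
proof (rule borel_measurable_SUP)
  show "countable {t \<in> \<rat>. 0 < H t \<and> H t < q}" by (rule countable_subset[OF _ countable_rat]) auto
  fix t assume t: "t \<in> {t \<in> \<rat>. 0 < H t \<and> H t < q}"
  show "(\<lambda>\<omega>. completed T E (nelson_aalen r M (g \<omega>) (x \<omega>) t, H t)) \<in> borel_measurable N"
    using t q by (intro measurable_compose[OF nelson_aalen_measurable[OF x g] completed_measurable]) auto
qed

text \<open>Substitution p = F t. As the data avoid the levels taken at rational points, the
  estimator at every \<open>t\<close> equals the transformed one at \<open>F t\<close>, and
  \<open>F\<close> maps the range of \<open>t\<close> onto the open interval from 0 to
  \<open>q\<close>.\<close>

lemma sup_statistic_eq:
  assumes F: "F \<in> ac_cdfs" and q: "q \<le> 1"
    and x: "\<And>i j. i \<in> {1..M} \<Longrightarrow> j \<in> {1..r} \<Longrightarrow> F (x i j) \<notin> F ` \<rat>"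
    and y: "\<And>i j. i \<in> {1..M} \<Longrightarrow> j \<in> {1..r} \<Longrightarrow> y i j = F (x i j)"
    and g: "\<And>j. j \<in> {1..r} \<Longrightarrow> g j = h j"
  shows "sup_statistic T E q F (nelson_aalen r M g x) = sup_statistic_uniform T E q (nelson_aalen r M h y)"
proof -
  have ord: "same_order r M x y"
    unfolding same_order_def using ac_cdf_less_iff(1)[OF F x] y by simp
  have "nelson_aalen r M g x t = nelson_aalen r M h y (F t)" for t
    using ac_cdf_less_iff(2)[OF F x] y by (intro nelson_aalen_same_order[OF ord g]) auto
  then show ?thesis
    unfolding sup_statistic_def sup_statistic_uniform_def quantile_interval[OF F] ac_cdf_image[OF F q, symmetric]
    by (simp add: image_image)
qed

end


section \<open>The three choices of weights\<close>

context
  fixes est :: "(real \<Rightarrow> real) \<Rightarrow> (nat \<Rightarrow> nat \<Rightarrow> real) \<Rightarrow> nat \<Rightarrow> real"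
    and \<gamma> :: "nat \<Rightarrow> real" and n r M :: nat
  assumes est: "est \<in> {(\<lambda>H x. \<gamma>), (\<lambda>H x. gamma_PL n r M x), (\<lambda>H x. gamma_ML n M H x)}"
begin

lemma est_measurable:
  assumes "\<And>i j. i \<in> {1..M} \<Longrightarrow> j \<in> {1..r} \<Longrightarrow> (\<lambda>\<omega>. x \<omega> i j) \<in> borel_measurable N"
    and "H \<in> borel_measurable borel" "j \<in> {1..r}"
  shows "(\<lambda>\<omega>. est H (x \<omega>) j) \<in> borel_measurable N"
  using est gamma_PL_measurable[of M r x N, OF assms(1)] gamma_ML_measurable[of M r x N, OF assms(1) assms(2,3)]
  by auto

text \<open>Fixed weights ignore the data, the profile likelihood weights see only their order, and
  the maximum likelihood weights see them only through the cdf, which becomes the identity on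
  transformed data.\<close>

lemma est_transform:
  assumes "same_order r M x y" "\<And>i l. i \<in> {1..M} \<Longrightarrow> l \<in> {1..r} \<Longrightarrow> y i l = H (x i l)" "j \<in> {1..r}"
  shows "est H x j = est (\<lambda>p. p) y j"
proof -
  have "gamma_ML n M H x j = gamma_ML n M (\<lambda>p. p) y j"
    by (rule gamma_ML_transform[of M r]) (use assms in auto)
  then show ?thesis using est gamma_PL_same_order[OF assms(1)] by auto
qed

end

section \<open>The statistic as a functional of the transformed sample\<close>

context
  fixes T :: "real \<times> real \<Rightarrow> real" and E :: "real \<times> real \<Rightarrow> ereal"
    and est :: "(real \<Rightarrow> real) \<Rightarrow> (nat \<Rightarrow> nat \<Rightarrow> real) \<Rightarrow> nat \<Rightarrow> real"
    and \<gamma> :: "nat \<Rightarrow> real" and n r M :: nat and q :: real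
  assumes T: "continuous_on ({0..1} \<times> {0<..<1}) T"
    and E: "continuous_on (({..<0} \<union> {1<..}) \<times> {0<..<1}) E"
    and est: "est \<in> {(\<lambda>H x. \<gamma>), (\<lambda>H x. gamma_PL n r M x), (\<lambda>H x. gamma_ML n M H x)}"
    and q: "q \<le> 1" and gamma: "\<forall>j\<in>{1..r}. 0 < \<gamma> j"
begin

definition plugin_stat :: "(real \<Rightarrow> real) \<Rightarrow> (nat \<Rightarrow> nat \<Rightarrow> real) \<Rightarrow> ereal" where
  "plugin_stat H x = sup_statistic T E q H (nelson_aalen r M (est H x) x)"

text \<open>The identity stands in for the uniform cdf, so even the maximum likelihood weights are
  computed from transformed data alone.\<close>

definition uniform_stat :: "(nat \<Rightarrow> nat \<Rightarrow> real) \<Rightarrow> ereal" where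
  "uniform_stat u = sup_statistic_uniform T E q (nelson_aalen r M (est (\<lambda>p. p) u) u)"

lemma uniform_stat_measurable:
  "uniform_stat \<in> borel_measurable (PiM {1..M} (\<lambda>_. PiM {1..r} (\<lambda>_. borel)))" (is "_ \<in> borel_measurable ?S")
proof -
  have u: "(\<lambda>u. u i j) \<in> borel_measurable ?S" if "i \<in> {1..M}" "j \<in> {1..r}" for i j
    using measurable_compose[OF measurable_component_singleton[OF that(1)] measurable_component_singleton[OF that(2)]] .
  have "(\<lambda>u. SUP p\<in>{p. 0 < p \<and> p < q}. completed T E (nelson_aalen r M (est (\<lambda>p. p) u) u p, p)) \<in> borel_measurable ?S"
    by (intro SUP_completed_measurable[OF T E _ q] u est_measurable[OF est]) auto
  moreover have "{p. 0 < p \<and> p < q} = {0<..<q}" by auto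
  ultimately show ?thesis by (simp add: uniform_stat_def[abs_def] sup_statistic_uniform_def)
qed

context
  fixes F :: "real \<Rightarrow> real" and P :: "'a measure" and X :: "nat \<Rightarrow> nat \<Rightarrow> 'a \<Rightarrow> real"
  assumes F: "F \<in> ac_cdfs" and X: "iid_sos_sample P r M \<gamma> F X"
begin

lemma sample_measurable: "i \<in> {1..M} \<Longrightarrow> j \<in> {1..r} \<Longrightarrow> X i j \<in> borel_measurable P"
  using X by (simp add: iid_sos_sample_def sequential_order_statistics_def)

lemma plugin_stat_measurable: "(\<lambda>\<omega>. plugin_stat F (\<lambda>i j. X i j \<omega>)) \<in> borel_measurable P"
  unfolding plugin_stat_def sup_statistic_def quantile_interval[OF F]
  by (intro SUP_completed_measurable[OF T E ac_cdf_cont[OF F] q] est_measurable[OF est] ac_cdf_borel[OF F])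
    (auto intro: sample_measurable)

lemma AE_sample_not_rational_level: "AE \<omega> in P. \<forall>i\<in>{1..M}. \<forall>j\<in>{1..r}. F (X i j \<omega>) \<notin> F ` \<rat>"
  using X AE_sos_not_rational_level[OF F _ gamma] by (auto simp: iid_sos_sample_def AE_finite_all)

text \<open>The almost sure identity of the theorem: on the right the weights still come from the
  original sample.\<close>

lemma AE_plugin_stat_eq_uniform:
  "AE \<omega> in P. plugin_stat F (\<lambda>i j. X i j \<omega>) =
    sup_statistic_uniform T E q (nelson_aalen r M (est F (\<lambda>i j. X i j \<omega>)) (\<lambda>i j. F (X i j \<omega>)))"
  using AE_sample_not_rational_level
  unfolding plugin_stat_def by eventually_elim (intro sup_statistic_eq[OF T E F q], blast+)

text \<open>Now the weights also come from the transformed sample, restricted to its index sets so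
  that it lies in the product space. In this form \<open>F\<close> enters only through the law of
  that sample.\<close>

lemma AE_plugin_stat_eq_uniform_stat:
  "AE \<omega> in P. plugin_stat F (\<lambda>i j. X i j \<omega>) = uniform_stat (\<lambda>i\<in>{1..M}. \<lambda>j\<in>{1..r}. F (X i j \<omega>))"
  using AE_sample_not_rational_level
proof eventually_elim
  case (elim \<omega>)
  let ?x = "\<lambda>i j. X i j \<omega>" and ?u = "\<lambda>i\<in>{1..M}. \<lambda>j\<in>{1..r}. F (X i j \<omega>)"
  have "same_order r M ?x ?u"
    unfolding same_order_def using ac_cdf_less_iff(1)[OF F] elim by simp
  then have "est F ?x j = est (\<lambda>p. p) ?u j" if "j \<in> {1..r}" for j
    using that by (intro est_transform[OF est]) auto
  then show ?case
    unfolding plugin_stat_def uniform_stat_def by (intro sup_statistic_eq[OF T E F q]) (use elim in auto)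
qed

lemma distr_plugin_stat:
  "distr P borel (\<lambda>\<omega>. plugin_stat F (\<lambda>i j. X i j \<omega>)) =
    distr (distr P (PiM {1..M} (\<lambda>_. PiM {1..r} (\<lambda>_. borel))) (\<lambda>\<omega>. \<lambda>i\<in>{1..M}. \<lambda>j\<in>{1..r}. F (X i j \<omega>))) borel uniform_stat"
proof -
  have V: "(\<lambda>\<omega>. \<lambda>i\<in>{1..M}. \<lambda>j\<in>{1..r}. F (X i j \<omega>)) \<in> measurable P (PiM {1..M} (\<lambda>_. PiM {1..r} (\<lambda>_. borel)))"
    by (intro measurable_restrict measurable_compose[OF sample_measurable ac_cdf_borel[OF F]])
  show ?thesis
    unfolding distr_distr[OF uniform_stat_measurable V] o_def
    by (rule distr_cong_AE[OF refl refl AE_plugin_stat_eq_uniform_stat plugin_stat_measurable measurable_compose[OF V uniform_stat_measurable]])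
qed

end

end

theorem theorem2:
  fixes n r M :: nat and \<gamma> :: "nat \<Rightarrow> real" and q :: real
    and T :: "real \<times> real \<Rightarrow> real" and E :: "real \<times> real \<Rightarrow> ereal"
    and F G :: "real \<Rightarrow> real"
    and P :: "'a measure" and X :: "nat \<Rightarrow> nat \<Rightarrow> 'a \<Rightarrow> real"
    and Q :: "'b measure" and Y :: "nat \<Rightarrow> nat \<Rightarrow> 'b \<Rightarrow> real"
    and est :: "(real \<Rightarrow> real) \<Rightarrow> (nat \<Rightarrow> nat \<Rightarrow> real) \<Rightarrow> nat \<Rightarrow> real"
  assumes "1 \<le> r" and "r \<le> n" and "1 \<le> M"
    and "\<forall>j\<in>{1..r}. 0 < \<gamma> j" and "\<gamma> 1 = real n"
    and "0 < q" and "q \<le> 1"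
    and "continuous_on ({0..1} \<times> {0<..<1}) T"
    and "continuous_on (({..<0} \<union> {1<..}) \<times> {0<..<1}) E"
    and "F \<in> ac_cdfs" and "iid_sos_sample P r M \<gamma> F X"
    and "G \<in> ac_cdfs" and "iid_sos_sample Q r M \<gamma> G Y"
    and "est \<in> {(\<lambda>H x. \<gamma>), (\<lambda>H x. gamma_PL n r M x), (\<lambda>H x. gamma_ML n M H x)}"
  shows "let stat = (\<lambda>H x. sup_statistic T E q H (nelson_aalen r M (est H x) x));
             stat_uniform = (\<lambda>H x. sup_statistic_uniform T E q
                               (nelson_aalen r M (est H x) (\<lambda>i j. H (x i j))))
         in (AE \<omega> in P. stat F (\<lambda>i j. X i j \<omega>) = stat_uniform F (\<lambda>i j. X i j \<omega>)) \<and>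
            (\<lambda>\<omega>. stat F (\<lambda>i j. X i j \<omega>)) \<in> borel_measurable P \<and>
            distr P borel (\<lambda>\<omega>. stat F (\<lambda>i j. X i j \<omega>)) =
              distr Q borel (\<lambda>\<omega>. stat G (\<lambda>i j. Y i j \<omega>))"
proof -
  note setting = assms(8,9,14,7,4)
  have "distr P borel (\<lambda>\<omega>. plugin_stat T E est r M q F (\<lambda>i j. X i j \<omega>)) =
      distr Q borel (\<lambda>\<omega>. plugin_stat T E est r M q G (\<lambda>i j. Y i j \<omega>))"
    unfolding distr_plugin_stat[OF setting assms(10,11)] distr_plugin_stat[OF setting assms(12,13)]
    by (subst iid_sample_transformed_law[OF assms(4,3,10-13)]) (rule refl)
  then show ?thesis
    using AE_plugin_stat_eq_uniform[OF setting assms(10,11)] plugin_stat_measurable[OF setting assms(10,11)]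
    unfolding Let_def plugin_stat_def[OF setting] by blast
qed

end
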